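(* Let $\mathbf{X}=(X_1,\dots,X_m)$ be a random vector with a density function $f(\mathbf{x})$ on a support $\Omega\subset\mathbb{R}^m$, let $g$ and $h$ be real-valued functions with $h$ continuous, and suppose that $h(\mathbf{x})$ is continuously differentiable for almost all $\mathbf{x}\in\Omega$ up to a Lebesgue null set. Let $(c_0,c_1)$ be the interval in which $h(\mathbf{x})$ may take values for $\mathbf{x}\in\Omega$ ($c_0=-\infty$ and $c_1=\infty$ allowed), let $\xi\in(c_0,c_1)$, and set $$\alpha(\xi)=\mathrm{E}\left[g(\mathbf{X})\cdot1_{\{h(\mathbf{X})\le\xi\}}\right],\qquad\alpha'(\xi)=\frac{d}{d\xi}\alpha(\xi).$$ Suppose that the mapping $\mathbf{x}\mapsto(x_1,\dots,x_{m-1},h(\mathbf{x}))$ is one-to-one on $\Omega$ and that $\Pr\{\partial_m h(\mathbf{X})=0\}=0$. Then $$\alpha(\xi)=\mathrm{E}\left[\widetilde w(\mathbf{X}_{-m};\xi)\right],$$ where $\mathbf{X}_{-m}=(X_1,\dots,X_{m-1})$ and $$\widetilde w(\mathbf{z};\xi)=\left.\int_{c_0}^{\xi}\frac{g(\mathbf{z},v(\mathbf{z},t))f(\mathbf{z},v(\mathbf{z},t))}{\tilde J(\mathbf{z},v(\mathbf{z},t))}\,dt\right/\int_{c_0}^{c_1}\frac{f(\mathbf{z},v(\mathbf{z},t))}{\tilde J(\mathbf{z},v(\mathbf{z},t))}\,dt .$$ If, in addition, $\widetilde w(\mathbf{X}_{-m};\cdot)$ satisfies a Lipschitz continuity condition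 with respect to $\xi$, i.e., there exists a random variable $K$ with $\mathrm{E}(K)<\infty$ such that for all small enough $\Delta$, $|\widetilde w(\mathbf{X}_{-m};\xi+\Delta)-\widetilde w(\mathbf{X}_{-m};\xi)|\le K|\Delta|$ with probability $1$, then $$\alpha'(\xi)=\mathrm{E}\left[\widetilde\nu(\mathbf{X}_{-m};\xi)\right],$$ where $$\widetilde\nu(\mathbf{z};\xi)=\left.\frac{g(\mathbf{z},v(\mathbf{z},\xi))f(\mathbf{z},v(\mathbf{z},\xi))}{\tilde J(\mathbf{z},v(\mathbf{z},\xi))}\right/\int_{c_0}^{c_1}\frac{f(\mathbf{z},v(\mathbf{z},t))}{\tilde J(\mathbf{z},v(\mathbf{z},t))}\,dt .$$
   Context: $\partial_m h(\mathbf{x})$ denotes the partial derivative of $h$ with respect to $x_m$, and $\tilde J(\mathbf{x})=|\partial_m h(\mathbf{x})|$. For $\mathbf{z}=(x_1,\dots,x_{m-1})$ and $t\in(c_0,c_1)$, $v(\mathbf{z},t)$ denotes the solution $x_m$ of the equation $h(\mathbf{z},x_m)=t$ with $(\mathbf{z},x_m)\in\Omega$, which is unique because $\mathbf{x}\mapsto(x_1,\dots,x_{m-1},h(\mathbf{x}))$ is one-to-one; expressions involving $v(\mathbf{z},t)$ are taken to be $0$ when no such solution exists. It is assumed that the expectation defining $\alpha$ exists. No smoothness is required of $g$, which may be discontinuous.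
   Formalization: The formula for α'(ξ) fails at single ξ (X uniform on (0,1), h(x)=x, g=1 except g(1/2)=0, ξ=1/2); it is proved for almost every ξ, and for every ξ at which t↦g·f/J̃ at (X_{-m},v(X_{-m},t)) is a.s. continuous at t=ξ. *)

theory Defs
  imports "HOL-Probability.Probability"
begin

(* R^m is the type real ^ 'm. The coordinate singled out in the text as the last one (x_m) is an
   index k :: 'm. The space R^(m-1) of the remaining coordinates is identified with the
   hyperplane {z. z $ k = 0}, which keeps the case m = 1 available. *)

definition insert_coord :: "'m \<Rightarrow> real ^ 'm \<Rightarrow> real \<Rightarrow> real ^ 'm::finite" where
  "insert_coord k z s = (\<chi> i. if i = k then s else z $ i)"

definition drop_coord :: "'m \<Rightarrow> real ^ 'm \<Rightarrow> real ^ 'm::finite" where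
  "drop_coord k x = insert_coord k x 0"

(* The value 0 is chosen where the partial derivative does not exist; deriv alone would return an
   unspecified number there. With x / 0 = 0, quotients by the absolute value of the partial
   derivative are then 0 at such points. *)
definition partial_deriv :: "'m \<Rightarrow> (real ^ 'm \<Rightarrow> real) \<Rightarrow> real ^ 'm::finite \<Rightarrow> real" where
  "partial_deriv k h x =
     (if (\<lambda>s. h (insert_coord k x s)) field_differentiable (at (x $ k))
      then deriv (\<lambda>s. h (insert_coord k x s)) (x $ k) else 0)"

definition J_tilde :: "'m \<Rightarrow> (real ^ 'm \<Rightarrow> real) \<Rightarrow> real ^ 'm::finite \<Rightarrow> real" where
  "J_tilde k h x = \<bar>partial_deriv k h x\<bar>"

definition C1_almost_everywhere_on ::
    "(real ^ 'm) set \<Rightarrow> (real ^ 'm::finite \<Rightarrow> real) \<Rightarrow> bool" where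
  "C1_almost_everywhere_on \<Omega> h \<longleftrightarrow>
     (\<exists>N \<in> null_sets lebesgue. \<exists>D :: real ^ 'm \<Rightarrow> real ^ 'm.
        (\<forall>x \<in> \<Omega> - N. (h has_derivative (\<lambda>y. D x \<bullet> y)) (at x)) \<and>
        continuous_on (\<Omega> - N) D)"

definition is_level_coord ::
    "'m \<Rightarrow> (real ^ 'm) set \<Rightarrow> (real ^ 'm \<Rightarrow> real) \<Rightarrow> real ^ 'm::finite \<Rightarrow> real \<Rightarrow> real \<Rightarrow> bool" where
  "is_level_coord k \<Omega> h z t s \<longleftrightarrow> insert_coord k z s \<in> \<Omega> \<and> h (insert_coord k z s) = t"

definition level_coord ::
    "'m \<Rightarrow> (real ^ 'm) set \<Rightarrow> (real ^ 'm \<Rightarrow> real) \<Rightarrow> real ^ 'm::finite \<Rightarrow> real \<Rightarrow> real" where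
  "level_coord k \<Omega> h z t = (THE s. is_level_coord k \<Omega> h z t s)"

(* The value \<phi>(z, v(z,t)), taken to be 0 when v(z,t) does not exist. *)
definition at_level ::
    "'m \<Rightarrow> (real ^ 'm) set \<Rightarrow> (real ^ 'm \<Rightarrow> real) \<Rightarrow> (real ^ 'm \<Rightarrow> real) \<Rightarrow> real ^ 'm::finite \<Rightarrow> real \<Rightarrow> real"
  where
  "at_level k \<Omega> h \<phi> z t =
     (if \<exists>s. is_level_coord k \<Omega> h z t s
      then \<phi> (insert_coord k z (level_coord k \<Omega> h z t)) else 0)"

definition range_lower :: "(real ^ 'm) set \<Rightarrow> (real ^ 'm::finite \<Rightarrow> real) \<Rightarrow> ereal" where
  "range_lower \<Omega> h = (INF x\<in>\<Omega>. ereal (h x))"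

definition range_upper :: "(real ^ 'm) set \<Rightarrow> (real ^ 'm::finite \<Rightarrow> real) \<Rightarrow> ereal" where
  "range_upper \<Omega> h = (SUP x\<in>\<Omega>. ereal (h x))"

definition num_integrand ::
    "'m \<Rightarrow> (real ^ 'm) set \<Rightarrow> (real ^ 'm \<Rightarrow> real) \<Rightarrow> (real ^ 'm \<Rightarrow> real) \<Rightarrow> (real ^ 'm \<Rightarrow> real) \<Rightarrow>
     real ^ 'm::finite \<Rightarrow> real \<Rightarrow> real" where
  "num_integrand k \<Omega> f g h = at_level k \<Omega> h (\<lambda>x. g x * f x / J_tilde k h x)"

definition den_integral ::
    "'m \<Rightarrow> (real ^ 'm) set \<Rightarrow> (real ^ 'm \<Rightarrow> real) \<Rightarrow> (real ^ 'm \<Rightarrow> real) \<Rightarrow> real ^ 'm::finite \<Rightarrow> real" where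
  "den_integral k \<Omega> f h z =
     (LINT t=range_lower \<Omega> h..range_upper \<Omega> h|lebesgue.
        at_level k \<Omega> h (\<lambda>x. f x / J_tilde k h x) z t)"

definition w_tilde ::
    "'m \<Rightarrow> (real ^ 'm) set \<Rightarrow> (real ^ 'm \<Rightarrow> real) \<Rightarrow> (real ^ 'm \<Rightarrow> real) \<Rightarrow> (real ^ 'm \<Rightarrow> real) \<Rightarrow>
     real ^ 'm::finite \<Rightarrow> real \<Rightarrow> real" where
  "w_tilde k \<Omega> f g h z \<xi> =
     (LINT t=range_lower \<Omega> h..ereal \<xi>|lebesgue. num_integrand k \<Omega> f g h z t)
       / den_integral k \<Omega> f h z"

definition nu_tilde ::
    "'m \<Rightarrow> (real ^ 'm) set \<Rightarrow> (real ^ 'm \<Rightarrow> real) \<Rightarrow> (real ^ 'm \<Rightarrow> real) \<Rightarrow> (real ^ 'm \<Rightarrow> real) \<Rightarrow>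
     real ^ 'm::finite \<Rightarrow> real \<Rightarrow> real" where
  "nu_tilde k \<Omega> f g h z \<xi> = num_integrand k \<Omega> f g h z \<xi> / den_integral k \<Omega> f h z"

definition alpha ::
    "'w measure \<Rightarrow> ('w \<Rightarrow> real ^ 'm) \<Rightarrow> (real ^ 'm \<Rightarrow> real) \<Rightarrow> (real ^ 'm::finite \<Rightarrow> real) \<Rightarrow> real \<Rightarrow> real" where
  "alpha M X g h \<xi> = (\<integral>\<omega>. g (X \<omega>) * indicat_real {..\<xi>} (h (X \<omega>)) \<partial>M)"

definition stoch_lipschitz_at :: "'w measure \<Rightarrow> ('w \<Rightarrow> real \<Rightarrow> real) \<Rightarrow> real \<Rightarrow> bool" where
  "stoch_lipschitz_at M W \<xi> \<longleftrightarrow>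
     (\<exists>K :: 'w \<Rightarrow> real. integrable M K \<and>
        (\<forall>\<^sub>F \<Delta> in at 0. AE \<omega> in M. \<bar>W \<omega> (\<xi> + \<Delta>) - W \<omega> \<xi>\<bar> \<le> K \<omega> * \<bar>\<Delta>\<bar>))"

end

(* Fix all coordinates but the k-th. On such a line h is injective on Omega, and the points where its
   partial derivative exists and is nonzero carry all of the mass of f; the one-dimensional change of
   variables t = h(z,s) turns integrals over s into integrals over t. With Fubini along the k-th
   coordinate this gives alpha(xi) = E[w(X_{-k}; xi)], the denominator of w being the marginal density
   of X_{-k}. A second use of Fubini writes alpha(xi) as the integral of t -> E[nu(X_{-k}; t)] over
   (c0, xi), so Lebesgue's differentiation theorem on the line gives the derivative at almost every xi.
   At a given xi where the numerator is continuous, w is differentiable in xi and the Lipschitz bound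
   dominates its difference quotients.

   M need not be complete, so agreeing almost everywhere with a measurable function does not make w
   and nu measurable. Instead, the inverse of (z,s) -> (z, h(z,s)) is shown to be Borel by
   covering the points of nonzero partial derivative with countably many compact sets on which this map
   is a homeomorphism onto its image. *)
theory Submission
  imports Defs
begin

text \<open>The value of \<open>nu_tilde\<close> at a fixed \<xi> depends on \<open>g\<close> on the
  level set \<open>h = \<xi>\<close>, whose part in \<Omega> meets each line along coordinate
  \<open>k\<close> at most once and is therefore a null set. Changing \<open>g\<close> there alters
  neither \<open>alpha\<close> nor \<open>w_tilde\<close>, so a Lipschitz bound on
  \<open>w_tilde\<close> cannot detect it. This obstacle splits the derivative statement in two:
  almost every \<xi> on the one hand, and a prescribed \<xi> at which continuity in the level
  variable pins the value down on the other. Since \<open>g\<close> may be discontinuous everywhere,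
  the expectation of \<open>nu_tilde\<close> is known only to be a locally integrable function of
  the level, and its indefinite integral is differentiated by a Vitali covering argument. The
  quotient \<open>w_tilde\<close> is a conditional expectation given the other coordinates, constant
  along each line; this is what makes integration line by line work. Partial derivatives may fail to
  exist at some points, so they are handled through difference quotients with rational bounds on
  boxes inside \<open>U\<close>, where \<open>h\<close> is continuous.\<close>

subsection \<open>Lebesgue differentiation on the line\<close>

text \<open>Outer regularity encloses \<open>A\<close> in an open set of small \<nu>-mass. Disjoint
  intervals inside it on which \<nu> exceeds \<epsilon> times the length have small total length,
  and Vitali's theorem lets such intervals cover the set up to a null set. The intervals contain
  \<open>x\<close> instead of being centred at it, so that both one-sided difference quotients can
  be treated later.\<close>

lemma negligible_upper_density_pos:
  fixes \<nu> :: "real measure"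
  assumes sets_nu: "sets \<nu> = sets borel" and fin: "emeasure \<nu> (space \<nu>) \<noteq> \<infinity>"
    and A: "A \<in> sets borel" "emeasure \<nu> A = 0" and eps: "0 < \<epsilon>"
  shows "negligible {x\<in>A. \<forall>d>0. \<exists>a b. a \<le> x \<and> x \<le> b \<and> a < b \<and> b - a < d \<and>
                        \<epsilon> * (b - a) < measure \<nu> {a..b}}"
    (is "negligible ?E")
proof (subst negligible_outer_le, intro allI impI)
  fix e :: real assume e: "0 < e"
  interpret finite_measure \<nu> using fin by (rule finite_measureI)
  \<comment> \<open>The bound \<open>e * \<epsilon>\<close> is chosen because the intervals below
    have total length at most \<open>1/\<epsilon>\<close> times the mass of
    \<open>U\<close>.\<close>
  have "(INF U \<in> {U. A \<subseteq> U \<and> open U}. emeasure \<nu> U) < ennreal (e * \<epsilon>)"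
    using outer_regular[OF sets_nu fin A(1)] A(2) e eps by simp
  then obtain U where U: "A \<subseteq> U" "open U" "emeasure \<nu> U < ennreal (e * \<epsilon>)"
    unfolding INF_less_iff by auto
  define K where "K = {(a, b). a < b \<and> {a..b} \<subseteq> U \<and> \<epsilon> * (b - a) < measure \<nu> {a..b}}"
  \<comment> \<open>The covering theorem speaks of balls, so an interval is encoded as the ball
    about its midpoint.\<close>
  have I_eq: "cball ((fst i + snd i) / 2) ((snd i - fst i) / 2) = {fst i..snd i}" for i :: "real \<times> real"
    by (auto simp: cball_eq_atLeastAtMost field_simps)
  obtain C where C: "countable C" "C \<subseteq> K"
     "pairwise (\<lambda>i j. disjnt {fst i..snd i} {fst j..snd j}) C"
     "negligible (?E - (\<Union>i \<in> C. {fst i..snd i}))"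
  proof (rule Vitali_covering_theorem_cballs[of K "\<lambda>i. (snd i - fst i) / 2" ?E
        "\<lambda>i. (fst i + snd i) / 2", unfolded I_eq])
    fix x d :: real assume x: "x \<in> ?E" and d: "0 < d"
    then have "x \<in> U" using U by auto
    then obtain r where r: "0 < r" "ball x r \<subseteq> U"
      using U(2) open_contains_ball by blast
    have "0 < min r d" using r(1) d by simp
    with x obtain a b where ab: "a \<le> x" "x \<le> b" "a < b" "b - a < min r d" "\<epsilon> * (b - a) < measure \<nu> {a..b}"
      by blast
    have "{a..b} \<subseteq> ball x r" using ab by (auto simp: dist_real_def)
    then have "(a, b) \<in> K" using ab r(2) by (auto simp: K_def)
    moreover have "(b - a) / 2 < d" using ab by (auto simp: min_less_iff_conj)
    ultimately show "\<exists>i. i \<in> K \<and> x \<in> {fst i..snd i} \<and> (snd i - fst i) / 2 < d"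
      using ab by (intro exI[of _ "(a, b)"]) auto
  qed (auto simp: K_def)
  let ?V = "\<Union>i\<in>C. {fst i..snd i}"
  have V[measurable]: "?V \<in> sets borel" using C(1) by (intro sets.countable_UN') auto
  have disj: "disjoint_family_on (\<lambda>i. {fst i..snd i}) C"
    using C(3) by (auto simp: disjoint_family_on_def pairwise_def disjnt_def)
  have "emeasure lborel ?V = (\<integral>\<^sup>+i. emeasure lborel {fst i..snd i} \<partial>count_space C)"
    using C(1) disj by (intro emeasure_UN_countable) auto
  also have "\<dots> \<le> (\<integral>\<^sup>+i. ennreal (1/\<epsilon>) * emeasure \<nu> {fst i..snd i} \<partial>count_space C)"
  proof (rule nn_integral_mono)
    fix i assume "i \<in> space (count_space C)"
    then have "i \<in> K" using C(2) by auto
    then have "fst i < snd i" "snd i - fst i \<le> (1/\<epsilon>) * measure \<nu> {fst i..snd i}"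
      using eps by (auto simp: K_def field_simps)
    then show "emeasure lborel {fst i..snd i} \<le> ennreal (1/\<epsilon>) * emeasure \<nu> {fst i..snd i}"
      using eps by (simp add: emeasure_eq_measure ennreal_mult'[symmetric])
  qed
  also have "\<dots> = ennreal (1/\<epsilon>) * emeasure \<nu> ?V"
    using C(1) disj by (subst emeasure_UN_countable) (auto simp: nn_integral_cmult sets_nu)
  also have "\<dots> \<le> ennreal (1/\<epsilon>) * emeasure \<nu> U"
  proof (intro mult_left_mono emeasure_mono)
    show "?V \<subseteq> U" using C(2) unfolding K_def by fastforce
  qed (use U(2) in \<open>auto simp: sets_nu\<close>)
  also have "\<dots> \<le> ennreal (1/\<epsilon>) * ennreal (e * \<epsilon>)"
    using U(3) by (intro mult_left_mono) auto
  also have "\<dots> = ennreal e" using e eps by (simp add: ennreal_mult'[symmetric])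
  finally have le: "emeasure lborel ?V \<le> ennreal e" .
  have V': "?V \<in> lmeasurable"
    using le_less_trans[OF le ennreal_less_top] by (intro fmeasurableI) auto
  have "measure lebesgue ?V \<le> e"
    using le e by (simp add: measure_def enn2real_leI)
  \<comment> \<open>What the intervals miss is negligible; adding it back gives a measurable
    superset without increasing the measure.\<close>
  moreover have "measure lebesgue (?V \<union> (?E - ?V)) = measure lebesgue ?V"
    using C(4) V' by (intro measure_Un_null_set) (auto simp: negligible_iff_null_sets)
  moreover have "?V \<union> (?E - ?V) \<in> lmeasurable"
    using C(4) V' negligible_imp_measurable by (intro fmeasurable.Un) auto
  ultimately show "\<exists>T. ?E \<subseteq> T \<and> T \<in> lmeasurable \<and> measure lebesgue T \<le> e"
    by (intro exI[of _ "?V \<union> (?E - ?V)"]) auto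
qed

text \<open>With \<open>q\<close> slightly above \<open>f x\<close> this is the upper half of the
  differentiation theorem at \<open>x\<close>; applied to \<open>-f\<close> it yields the lower
  half.\<close>

lemma AE_average_le:
  fixes f :: "real \<Rightarrow> real"
  assumes f: "integrable lborel f"
  shows "AE x in lborel. f x \<le> q \<longrightarrow> (\<forall>\<epsilon>>0. \<exists>d>0. \<forall>a b. a \<le> x \<and> x \<le> b \<and> a < b \<and> b - a < d \<longrightarrow>
            (LINT t:{a..b}|lborel. f t) \<le> (q + \<epsilon>) * (b - a))"
proof -
  have fm[measurable]: "f \<in> borel_measurable borel" using f by auto
  \<comment> \<open>\<open>(f - q)\<^sup>+\<close> gives no mass to \<open>{f \<le> q}\<close>, hence has upper density 0 at almost every point of that
    set; the cutoff makes it integrable when \<open>q < 0\<close>.\<close>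
  define g where "g N = (\<lambda>t. max 0 (f t - q) * indicat_real {-real N..real N} t)" for N :: nat
  define E where "E n N = {x\<in>{x. f x \<le> q}. \<forall>d>0. \<exists>a b. a \<le> x \<and> x \<le> b \<and> a < b \<and> b - a < d \<and>
      1 / real (Suc n) * (b - a) < measure (density lborel (g N)) {a..b}}" for n N
  have g_int: "integrable lborel (g N)" for N
  proof -
    have "integrable lborel (\<lambda>t. (\<bar>f t\<bar> * indicat_real {-real N..real N} t +
        \<bar>q\<bar> * indicat_real {-real N..real N} t))"
      using f by (intro Bochner_Integration.integrable_add integrable_mult_right
          integrable_real_mult_indicator integrable_abs integrable_real_indicator) 
        (auto simp: emeasure_lborel_Icc_eq)
    then show ?thesis
      by (rule Bochner_Integration.integrable_bound) (auto simp: g_def indicator_def max_def)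
  qed
  have g_nn: "0 \<le> g N t" for N t by (auto simp: g_def)
  have fin: "emeasure (density lborel (g N)) UNIV = ennreal (integral\<^sup>L lborel (g N))" for N
    using g_int[of N] g_nn by (simp add: emeasure_density nn_integral_eq_integral)
  have "negligible (E n N)" for n N
    unfolding E_def
  proof (rule negligible_upper_density_pos)
    show "emeasure (density lborel (\<lambda>x. ennreal (g N x))) {x. f x \<le> q} = 0"
      using g_int[of N] by (subst emeasure_density)
        (auto simp: nn_integral_0_iff_AE g_def indicator_def)
  qed (use fin[of N] in auto)
  then have "AE x in lebesgue. \<forall>n N. x \<notin> E n N"
    unfolding AE_all_countable negligible_iff_null_sets by (auto intro: AE_not_in)
  then have "AE x in lborel. \<forall>n N. x \<notin> E n N" by (simp add: AE_completion_iff)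
  then show ?thesis
  proof (eventually_elim, intro impI allI)
    fix x \<epsilon> :: real assume x: "\<forall>n N. x \<notin> E n N" "f x \<le> q" "0 < \<epsilon>"
    obtain n where n: "1 / real (Suc n) < \<epsilon>" using x(3) nat_approx_posE by blast
    obtain N where N: "\<bar>x\<bar> < real N" using reals_Archimedean2 by blast
    have "x \<notin> E n N" using x(1) by blast
    then have "\<not> (\<forall>d>0. \<exists>a b. a \<le> x \<and> x \<le> b \<and> a < b \<and> b - a < d \<and>
      1 / real (Suc n) * (b - a) < measure (density lborel (g N)) {a..b})"
      using x(2) unfolding E_def by blast
    then obtain d where d: "d > 0" and nle: "\<not> (\<exists>a b. a \<le> x \<and> x \<le> b \<and> a < b \<and> b - a < d \<and>
      1 / real (Suc n) * (b - a) < measure (density lborel (g N)) {a..b})"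
      by blast
    have le: "measure (density lborel (g N)) {a..b} \<le> 1 / real (Suc n) * (b - a)"
      if "a \<le> x" "x \<le> b" "a < b" "b - a < d" for a b
      using nle that not_le by blast
    \<comment> \<open>The radius is capped by \<open>real N - \<bar>x\<bar>\<close> so that every
      admissible interval lies where the cutoff in \<open>g N\<close> equals 1.\<close>
    show "\<exists>d>0. \<forall>a b. a \<le> x \<and> x \<le> b \<and> a < b \<and> b - a < d \<longrightarrow>
            (LINT t:{a..b}|lborel. f t) \<le> (q + \<epsilon>) * (b - a)"
    proof (intro exI[of _ "min d (real N - \<bar>x\<bar>)"] conjI allI impI)
      fix a b assume ab: "a \<le> x \<and> x \<le> b \<and> a < b \<and> b - a < min d (real N - \<bar>x\<bar>)"
      have "(LINT t:{a..b}|lborel. f t) - q * (b - a) = (LINT t:{a..b}|lborel. f t - q)"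
      proof (subst set_integral_diff)
        show "set_integrable lborel {a..b} f"
          using f unfolding set_integrable_def by (intro integrable_mult_indicator) auto
        show "set_integrable lborel {a..b} (\<lambda>x. q)"
          unfolding set_integrable_def by (intro integrable_scaleR_left integrable_real_indicator)
            (auto simp: emeasure_lborel_Icc_eq)
      qed (use ab in \<open>simp add: set_lebesgue_integral_def\<close>)
      also have "\<dots> \<le> (LINT t:{a..b}|lborel. g N t)"
      proof (rule set_integral_mono)
        show "set_integrable lborel {a..b} (\<lambda>t. f t - q)"
          using f unfolding set_integrable_def scaleR_diff_right
          by (intro Bochner_Integration.integrable_diff integrable_mult_indicator 
              integrable_scaleR_left integrable_real_indicator)
            (auto simp: emeasure_lborel_Icc_eq)
        show "set_integrable lborel {a..b} (g N)"
          using g_int[of N] unfolding set_integrable_def by (intro integrable_mult_indicator) auto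
        show "f t - q \<le> g N t" if "t \<in> {a..b}" for t
          using that ab by (auto simp: g_def indicator_def)
      qed
      also have "\<dots> = measure (density lborel (g N)) {a..b}"
      proof -
        have "emeasure (density lborel (g N)) {a..b} = (\<integral>\<^sup>+t. ennreal (indicator {a..b} t * g N t) \<partial>lborel)"
          using g_int[of N] by (subst emeasure_density) (auto intro!: nn_integral_cong simp: indicator_def)
        also have "\<dots> = ennreal (\<integral>t. indicator {a..b} t * g N t \<partial>lborel)"
          using g_int[of N] g_nn[of N] integrable_mult_indicator[of "{a..b}" lborel "g N"]
          by (subst nn_integral_eq_integral) auto
        finally show ?thesis
          using g_nn[of N] by (simp add: measure_def set_lebesgue_integral_def)
      qed
      also have "\<dots> \<le> 1 / real (Suc n) * (b - a)" using ab by (intro le) auto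
      also have "\<dots> \<le> \<epsilon> * (b - a)" using n ab by (intro mult_right_mono) auto
      finally show "(LINT t:{a..b}|lborel. f t) \<le> (q + \<epsilon>) * (b - a)" by (simp add: algebra_simps)
    qed (use d N in auto)
  qed
qed

text \<open>Rational thresholds keep the exceptional set a countable union of null sets. A rational
  strictly between \<open>f x\<close> and a target \<open>u\<close> leaves a gap; half of it is
  spent as \<epsilon>, so the quotients stay strictly on the right side of \<open>u\<close>.\<close>

theorem AE_has_real_derivative_indefinite_integral:
  fixes f :: "real \<Rightarrow> real"
  assumes f: "integrable lborel f"
  shows "AE x in lborel. ((\<lambda>y. LINT t:{..y}|lborel. f t) has_real_derivative f x) (at x)"
proof -
  define F where "F y = (LINT t:{..y}|lborel. f t)" for y
  have fm[measurable]: "f \<in> borel_measurable borel" using f by auto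
  have si: "set_integrable lborel A f" if "A \<in> sets borel" for A
    using f that unfolding set_integrable_def by (intro integrable_mult_indicator) auto
  have F_diff: "F y - F x = (LINT t:{x..y}|lborel. f t)" if "x < y" for x y
  proof -
    have "{..y} = {..x} \<union> {x<..y}" using that by auto
    then have "F y = F x + (LINT t:{x<..y}|lborel. f t)"
      unfolding F_def by (simp, subst set_integral_Un) (auto intro: si)
    also have "(LINT t:{x<..y}|lborel. f t) = (LINT t:{x..y}|lborel. f t)"
      unfolding set_lebesgue_integral_def using AE_lborel_singleton[of x]
      by (intro integral_cong_AE) (auto simp: indicator_def elim: eventually_mono)
    finally show ?thesis by simp
  qed
  have "AE x in lborel. \<forall>q::rat. f x \<le> of_rat q \<longrightarrow> (\<forall>\<epsilon>>0. \<exists>d>0. \<forall>a b. a \<le> x \<and> x \<le> b \<and> a < b \<and> b - a < d \<longrightarrow>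
            (LINT t:{a..b}|lborel. f t) \<le> (of_rat q + \<epsilon>) * (b - a))"
    unfolding AE_all_countable by (intro allI AE_average_le f)
  moreover have "AE x in lborel. \<forall>q::rat. - f x \<le> of_rat q \<longrightarrow> (\<forall>\<epsilon>>0. \<exists>d>0. \<forall>a b. a \<le> x \<and> x \<le> b \<and> a < b \<and> b - a < d \<longrightarrow>
            (LINT t:{a..b}|lborel. - f t) \<le> (of_rat q + \<epsilon>) * (b - a))"
    unfolding AE_all_countable using f by (intro allI AE_average_le) auto
  ultimately show ?thesis
  proof eventually_elim
    case (elim x)
    have upper: "\<forall>\<^sub>F y in at x. (F y - F x) / (y - x) < u" if "f x < u" for u
    proof -
      obtain q :: rat where q: "f x < of_rat q" "of_rat q < u" using \<open>f x < u\<close> of_rat_dense by blast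
      define \<epsilon> where "\<epsilon> = (u - of_rat q) / 2"
      have "of_rat q + \<epsilon> < u" "0 < \<epsilon>" using q by (auto simp: \<epsilon>_def field_simps)
      with elim(1) q(1) obtain d where d: "d > 0" and le: "\<forall>a b. a \<le> x \<and> x \<le> b \<and> a < b \<and> b - a < d \<longrightarrow>
            (LINT t:{a..b}|lborel. f t) \<le> (of_rat q + \<epsilon>) * (b - a)"
        using less_imp_le by blast
      have *: "F b - F a \<le> (of_rat q + \<epsilon>) * (b - a)" if "a \<le> x" "x \<le> b" "a < b" "b - a < d" for a b
        using le that F_diff[of a b] by simp
      show ?thesis
        unfolding eventually_at
      proof (intro exI[of _ d] conjI ballI impI d)
        fix y assume y: "y \<noteq> x \<and> dist y x < d"
        have "(F y - F x) / (y - x) \<le> of_rat q + \<epsilon>"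
        proof (cases "x < y")
          case True then show ?thesis using *[of x y] y by (auto simp: dist_real_def divide_simps)
        next
          case False then show ?thesis using *[of y x] y 
            by (auto simp: dist_real_def divide_simps algebra_simps)
        qed
        then show "(F y - F x) / (y - x) < u" using \<open>of_rat q + \<epsilon> < u\<close> by linarith
      qed
    qed
    have lower: "\<forall>\<^sub>F y in at x. u < (F y - F x) / (y - x)" if "u < f x" for u
    proof -
      have "- f x < - u" using that by simp
      then obtain q :: rat where q: "- f x < of_rat q" "of_rat q < - u" using of_rat_dense by blast
      define \<epsilon> where "\<epsilon> = (- u - of_rat q) / 2"
      have "of_rat q + \<epsilon> < - u" "0 < \<epsilon>" using q by (auto simp: \<epsilon>_def field_simps)
      with elim(2) q(1) obtain d where d: "d > 0" and le: "\<forall>a b. a \<le> x \<and> x \<le> b \<and> a < b \<and> b - a < d \<longrightarrow>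
            (LINT t:{a..b}|lborel. - f t) \<le> (of_rat q + \<epsilon>) * (b - a)"
        using less_imp_le by blast
      have *: "- (F b - F a) \<le> (of_rat q + \<epsilon>) * (b - a)" if "a \<le> x" "x \<le> b" "a < b" "b - a < d" for a b
        using le that F_diff[of a b] by (simp add: set_lebesgue_integral_def)
      show ?thesis
        unfolding eventually_at
      proof (intro exI[of _ d] conjI ballI impI d)
        fix y assume y: "y \<noteq> x \<and> dist y x < d"
        have "- ((F y - F x) / (y - x)) \<le> of_rat q + \<epsilon>"
        proof (cases "x < y")
          case True then show ?thesis using *[of x y] y by (auto simp: dist_real_def divide_simps)
        next
          case False then show ?thesis using *[of y x] y 
            by (auto simp: dist_real_def divide_simps algebra_simps)
        qed
        then show "u < (F y - F x) / (y - x)" using \<open>of_rat q + \<epsilon> < - u\<close> by linarith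
      qed
    qed
    have "((\<lambda>y. (F y - F x) / (y - x)) \<longlongrightarrow> f x) (at x)"
      by (rule order_tendstoI) (use upper lower in auto)
    then show ?case by (simp add: has_field_derivative_iff F_def)
  qed
qed

text \<open>The fundamental theorem at a point of continuity lives on a compact interval. Splitting
  the half-line at \<open>x - 1\<close> leaves a constant summand, which the derivative at
  \<open>x\<close> does not see.\<close>

lemma has_real_derivative_integral_isCont:
  fixes f :: "real \<Rightarrow> real"
  assumes f: "integrable lborel f" and cont: "isCont f x"
  shows "((\<lambda>y. LINT t:{..y}|lborel. f t) has_real_derivative f x) (at x)"
proof -
  have [measurable]: "f \<in> borel_measurable borel" using f by auto
  have si: "set_integrable lborel A f" if "A \<in> sets borel" for A
    using f that unfolding set_integrable_def by (intro integrable_mult_indicator) auto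
  have "((\<lambda>u. integral {x - 1..u} f) has_vector_derivative f x) (at x within {x - 1..x + 1})"
  proof (rule integral_has_vector_derivative_continuous_at[where S="{}", simplified])
    show "f integrable_on {x - 1..x + 1}" using set_borel_integral_eq_integral(1)[OF si] by simp
    show "continuous (at x within {x - 1..x + 1}) f"
      using cont by (rule continuous_within_subset) simp
  qed auto
  then have "((\<lambda>u. integral {x - 1..u} f) has_vector_derivative f x) (at x)"
    by (simp add: at_within_Icc_at)
  then have "((\<lambda>u. integral {x - 1..u} f) has_real_derivative f x) (at x)"
    by (simp add: has_real_derivative_iff_has_vector_derivative)
  then have "((\<lambda>u. (LINT t:{..<x - 1}|lborel. f t) + integral {x - 1..u} f) has_real_derivative f x) (at x)"
    by (auto intro!: derivative_eq_intros)
  then show ?thesis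
  proof (rule has_field_derivative_transform_within_open)
    show "open {x - 1<..}" by simp
    fix y assume y: "y \<in> {x - 1<..}"
    then have "{..y} = {..<x - 1} \<union> {x - 1..y}" by auto
    then have "(LINT t:{..y}|lborel. f t) = (LINT t:{..<x - 1}|lborel. f t) + (LINT t:{x - 1..y}|lborel. f t)"
      by (simp, subst set_integral_Un) (auto intro: si)
    also have "(LINT t:{x - 1..y}|lborel. f t) = integral {x - 1..y} f"
      by (rule set_borel_integral_eq_integral) (simp add: si)
    finally show "(LINT t:{..<x - 1}|lborel. f t) + integral {x - 1..y} f = (LINT t:{..y}|lborel. f t)" ..
  qed auto
qed

subsection \<open>Slices along a coordinate\<close>

lemma insert_coord_nth [simp]: "insert_coord k x s $ i = (if i = k then s else x $ i)"
  by (simp add: insert_coord_def)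

lemma insert_coord_insert_coord [simp]:
  "insert_coord k (insert_coord k x s) t = insert_coord k x t"
  by (simp add: vec_eq_iff)

lemma insert_coord_nth_same [simp]: "insert_coord k x (x $ k) = x"
  by (simp add: vec_eq_iff)

lemma insert_coord_drop_coord [simp]: "insert_coord k (drop_coord k x) s = insert_coord k x s"
  by (simp add: drop_coord_def)

lemma insert_coord_eq_plus: "insert_coord k x s = x + (s - x $ k) *\<^sub>R axis k 1"
  by (simp add: vec_eq_iff axis_def)

lemma continuous_on_insert_coord [continuous_intros]:
  assumes "continuous_on A f" "continuous_on A g"
  shows "continuous_on A (\<lambda>x. insert_coord k (f x) (g x))"
  unfolding insert_coord_eq_plus using assms by (intro continuous_intros)

lemma continuous_on_drop_coord: "continuous_on A (drop_coord k)"
  unfolding drop_coord_def by (intro continuous_intros)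

lemma measurable_insert_coord [measurable]:
  "(\<lambda>p. insert_coord k (fst p) (snd p)) \<in> borel \<Otimes>\<^sub>M borel \<rightarrow>\<^sub>M borel"
  unfolding borel_prod
  by (intro borel_measurable_continuous_onI continuous_intros)

lemma measurable_insert_coord' [measurable (raw)]:
  assumes "f \<in> M \<rightarrow>\<^sub>M borel" "g \<in> M \<rightarrow>\<^sub>M borel"
  shows "(\<lambda>x. insert_coord k (f x) (g x)) \<in> M \<rightarrow>\<^sub>M borel"
  using measurable_compose[OF measurable_Pair[OF assms] measurable_insert_coord[of k]] by simp

lemma measurable_vec_nth [measurable]: "(\<lambda>x. x $ i) \<in> borel_measurable (borel :: (real ^ 'm::finite) measure)"
  by (intro borel_measurable_continuous_onI continuous_intros)

text \<open>Any unit slab represents the hyperplane of the remaining coordinates: everything integrated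
  against this measure below is constant in the \<open>k\<close>-th coordinate.\<close>

definition slab :: "'m \<Rightarrow> (real ^ 'm::finite) measure" where
  "slab k = density lborel (indicator {x. x $ k \<in> {0..1}})"

lemma sets_slab [simp, measurable_cong]: "sets (slab k) = sets borel"
  and space_slab [simp]: "space (slab k) = UNIV"
  by (simp_all add: slab_def)

section \<open>Fubini's theorem along one coordinate\<close>

lemma sigma_finite_slab: "sigma_finite_measure (slab k)"
  unfolding slab_def
  by (subst sigma_finite_measure.sigma_finite_iff_density_finite[OF lborel.sigma_finite_measure_axioms])
    (auto split: split_indicator)

lemma pair_sigma_finite_slab: "pair_sigma_finite (slab k) (lborel :: real measure)"
  by (intro pair_sigma_finite.intro sigma_finite_slab lborel.sigma_finite_measure_axioms)

text \<open>After a shift of \<open>s\<close>, inserting a coordinate is translation along the axis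
  vector. Exchanging the integrals and translating \<open>x\<close> instead gives each
  \<open>y\<close> a weight: the length of the set of \<open>s\<close> that carry \<open>y\<close>
  back into the slab. This set is an interval of length 1, whence the unit width.\<close>

lemma nn_integral_slices:
  fixes F :: "real ^ 'm::finite \<Rightarrow> ennreal"
  assumes [measurable]: "F \<in> borel_measurable borel"
  shows "(\<integral>\<^sup>+x. \<integral>\<^sup>+s. F (insert_coord k x s) \<partial>lborel \<partial>slab k) = (\<integral>\<^sup>+y. F y \<partial>lborel)"
proof -
  define I :: "real ^ 'm \<Rightarrow> ennreal" where "I = indicator {x. x $ k \<in> {0..1}}"
  have [measurable]: "I \<in> borel_measurable borel" by (simp add: I_def)
  let ?e = "axis k 1 :: real ^ 'm"
  have nth: "?e $ k = 1" by (simp add: axis_def)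
  have "(\<integral>\<^sup>+x. \<integral>\<^sup>+s. F (insert_coord k x s) \<partial>lborel \<partial>slab k) =
        (\<integral>\<^sup>+x. I x * (\<integral>\<^sup>+s. F (insert_coord k x s) \<partial>lborel) \<partial>lborel)"
    unfolding slab_def I_def by (subst nn_integral_density) auto
  also have "\<dots> = (\<integral>\<^sup>+x. I x * (\<integral>\<^sup>+s. F (x + s *\<^sub>R ?e) \<partial>lborel) \<partial>lborel)"
  proof (rule nn_integral_cong)
    fix x :: "real ^ 'm"
    show "I x * (\<integral>\<^sup>+s. F (insert_coord k x s) \<partial>lborel) = I x * (\<integral>\<^sup>+s. F (x + s *\<^sub>R ?e) \<partial>lborel)"
      by (subst nn_integral_real_affine[where t="x $ k" and c=1]) (auto simp: insert_coord_eq_plus)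
  qed
  also have "\<dots> = (\<integral>\<^sup>+x. \<integral>\<^sup>+s. I x * F (x + s *\<^sub>R ?e) \<partial>lborel \<partial>lborel)"
    by (intro nn_integral_cong nn_integral_cmult[symmetric]) auto
  also have "\<dots> = (\<integral>\<^sup>+s. \<integral>\<^sup>+x. I x * F (x + s *\<^sub>R ?e) \<partial>lborel \<partial>lborel)"
    by (rule lborel_pair.Fubini') measurable
  also have "\<dots> = (\<integral>\<^sup>+s. \<integral>\<^sup>+y. I (y - s *\<^sub>R ?e) * F y \<partial>lborel \<partial>lborel)"
  proof (rule nn_integral_cong)
    fix s :: real
    have "(\<integral>\<^sup>+y. I (y - s *\<^sub>R ?e) * F y \<partial>lborel) =
          (\<integral>\<^sup>+y. I (y - s *\<^sub>R ?e) * F y \<partial>distr lborel borel ((+) (s *\<^sub>R ?e)))"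
      by (simp add: lborel_distr_plus)
    also have "\<dots> = (\<integral>\<^sup>+x. I x * F (x + s *\<^sub>R ?e) \<partial>lborel)"
      by (subst nn_integral_distr) (auto simp: add.commute)
    finally show "(\<integral>\<^sup>+x. I x * F (x + s *\<^sub>R ?e) \<partial>lborel) = (\<integral>\<^sup>+y. I (y - s *\<^sub>R ?e) * F y \<partial>lborel)" ..
  qed
  also have "\<dots> = (\<integral>\<^sup>+y. \<integral>\<^sup>+s. I (y - s *\<^sub>R ?e) * F y \<partial>lborel \<partial>lborel)"
    by (rule lborel_pair.Fubini'[symmetric]) measurable
  also have "\<dots> = (\<integral>\<^sup>+y. F y \<partial>lborel)"
  proof (rule nn_integral_cong)
    fix y :: "real ^ 'm"
    have "(\<integral>\<^sup>+s. I (y - s *\<^sub>R ?e) * F y \<partial>lborel) =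
          (\<integral>\<^sup>+s. F y * indicator {y $ k - 1..y $ k} s \<partial>lborel)"
      by (intro nn_integral_cong) (auto simp: I_def indicator_def nth)
    then show "(\<integral>\<^sup>+s. I (y - s *\<^sub>R ?e) * F y \<partial>lborel) = F y"
      by (simp add: nn_integral_cmult)
  qed
  finally show ?thesis .
qed

text \<open>The image-measure form of the slicing identity, through which integrability and
  almost-everywhere statements pass as well.\<close>

lemma distr_slab_insert_coord:
  "distr (slab k \<Otimes>\<^sub>M lborel) borel (\<lambda>(x, s). insert_coord k x s) = lborel"
proof -
  interpret pair_sigma_finite "slab k" "lborel :: real measure" by (rule pair_sigma_finite_slab)
  have m: "(\<lambda>(x, s). insert_coord k x s) \<in> slab k \<Otimes>\<^sub>M lborel \<rightarrow>\<^sub>M borel" by measurable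
  show ?thesis
  proof (rule measure_eqI)
    fix A assume "A \<in> sets (distr (slab k \<Otimes>\<^sub>M lborel) borel (\<lambda>(x, s). insert_coord k x s))"
    then have A[measurable]: "A \<in> sets borel" by simp
    have "emeasure (distr (slab k \<Otimes>\<^sub>M lborel) borel (\<lambda>(x, s). insert_coord k x s)) A =
          (\<integral>\<^sup>+y. indicator A y \<partial>distr (slab k \<Otimes>\<^sub>M lborel) borel (\<lambda>(x, s). insert_coord k x s))"
      by (simp add: nn_integral_indicator)
    also have "\<dots> = (\<integral>\<^sup>+p. indicator A (insert_coord k (fst p) (snd p)) \<partial>(slab k \<Otimes>\<^sub>M lborel))"
      by (subst nn_integral_distr[OF m]) (auto simp: case_prod_beta)
    also have "\<dots> = (\<integral>\<^sup>+x. \<integral>\<^sup>+s. indicator A (insert_coord k x s) \<partial>lborel \<partial>slab k)"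
      by (subst lborel.nn_integral_fst[symmetric]) auto
    also have "\<dots> = emeasure lborel A"
      by (subst nn_integral_slices) auto
    finally show "emeasure (distr (slab k \<Otimes>\<^sub>M lborel) borel (\<lambda>(x, s). insert_coord k x s)) A =
        emeasure lborel A" .
  qed simp
qed

lemma integrable_slices_iff:
  fixes F :: "real ^ 'm::finite \<Rightarrow> real"
  assumes [measurable]: "F \<in> borel_measurable borel"
  shows "integrable (slab k \<Otimes>\<^sub>M lborel) (\<lambda>p. F (insert_coord k (fst p) (snd p))) \<longleftrightarrow> integrable lborel F"
  by (subst distr_slab_insert_coord[of k, symmetric], subst integrable_distr_eq)
    (auto simp: case_prod_beta)

lemma integrable_slices:
  fixes F :: "real ^ 'm::finite \<Rightarrow> real"
  assumes F: "integrable lborel F"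
  shows AE_integrable_slice: "AE x in slab k. integrable lborel (\<lambda>s. F (insert_coord k x s))"
    and integrable_slice_integral: "integrable (slab k) (\<lambda>x. \<integral>s. F (insert_coord k x s) \<partial>lborel)"
    and integral_slices: "(\<integral>x. \<integral>s. F (insert_coord k x s) \<partial>lborel \<partial>slab k) = integral\<^sup>L lborel F"
proof -
  interpret pair_sigma_finite "slab k" "lborel :: real measure" by (rule pair_sigma_finite_slab)
  have [measurable]: "F \<in> borel_measurable borel" using F by auto
  have int: "integrable (slab k \<Otimes>\<^sub>M lborel) (\<lambda>p. F (insert_coord k (fst p) (snd p)))"
    using F by (simp add: integrable_slices_iff)
  show "AE x in slab k. integrable lborel (\<lambda>s. F (insert_coord k x s))"
    using AE_integrable_fst'[OF int] by simp
  show "integrable (slab k) (\<lambda>x. \<integral>s. F (insert_coord k x s) \<partial>lborel)"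
    using integrable_fst'[OF int] by simp
  have "(\<integral>x. \<integral>s. F (insert_coord k x s) \<partial>lborel \<partial>slab k) =
    (\<integral>p. F (insert_coord k (fst p) (snd p)) \<partial>(slab k \<Otimes>\<^sub>M lborel))"
    using integral_fst'[OF int] by (simp add: case_prod_beta)
  also have "\<dots> = integral\<^sup>L (distr (slab k \<Otimes>\<^sub>M lborel) borel (\<lambda>(x, s). insert_coord k x s)) F"
    by (subst integral_distr) (auto simp: case_prod_beta)
  finally show "(\<integral>x. \<integral>s. F (insert_coord k x s) \<partial>lborel \<partial>slab k) = integral\<^sup>L lborel F"
    by (simp add: distr_slab_insert_coord)
qed

lemma AE_slices:
  assumes "AE y in lborel. P y"
  shows "AE x in slab k. AE s in lborel. P (insert_coord k x s)"
proof -
  interpret pair_sigma_finite "slab k" "lborel :: real measure" by (rule pair_sigma_finite_slab)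
  have "AE y in distr (slab k \<Otimes>\<^sub>M lborel) borel (\<lambda>(x, s). insert_coord k x s). P y"
    unfolding distr_slab_insert_coord using assms .
  then have "AE p in slab k \<Otimes>\<^sub>M lborel. P (case p of (x, s) \<Rightarrow> insert_coord k x s)"
    by (rule AE_distrD[rotated]) measurable
  from AE_pair[OF this] show ?thesis by simp
qed

text \<open>By invariance, \<open>P\<close> holds on the whole line through \<open>x\<close> as soon
  as it holds at \<open>x\<close>; the failure set then has almost only empty slices.\<close>

lemma AE_if_AE_slab:
  fixes P :: "real ^ 'm::finite \<Rightarrow> bool"
  assumes [measurable]: "Measurable.pred borel P"
    and inv: "\<And>x s. P (insert_coord k x s) = P x" and ae: "AE x in slab k. P x"
  shows "AE y in lborel. P y"
proof -
  have "(\<integral>\<^sup>+y. indicator {y. \<not> P y} y \<partial>lborel) =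
      (\<integral>\<^sup>+x. \<integral>\<^sup>+s. indicator {y. \<not> P y} (insert_coord k x s) \<partial>(lborel :: real measure) \<partial>slab k)"
    by (rule nn_integral_slices[symmetric]) measurable
  also have "\<dots> = (\<integral>\<^sup>+x. 0 \<partial>slab k)"
    using ae by (intro nn_integral_cong_AE) (auto simp: inv elim: eventually_mono)
  finally have "emeasure lborel {y. \<not> P y} = 0" by simp
  then show ?thesis by (subst AE_iff_measurable[OF _ refl]) auto
qed

subsection \<open>Difference quotients along a coordinate\<close>

text \<open>Both kinds of box are needed later: the closed one for compactness, the open one so that
  limits at \<open>x\<close> can be taken inside. The corners are picked from a countable dense set
  in the boxes spanned by \<open>x\<close> and the corners of a larger box.\<close>

lemma countable_box_basis:
  obtains R :: "((real ^ 'm::finite) \<times> (real ^ 'm)) set" where "countable R"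
    "\<And>x V. open V \<Longrightarrow> x \<in> V \<Longrightarrow> \<exists>(p, q)\<in>R. x \<in> box p q \<and> cbox p q \<subseteq> V"
proof -
  obtain D :: "(real ^ 'm) set" where D: "countable D" "\<And>X. open X \<Longrightarrow> X \<noteq> {} \<Longrightarrow> \<exists>d\<in>D. d \<in> X"
    using countable_dense_setE by blast
  have "\<exists>(p, q)\<in>D \<times> D. x \<in> box p q \<and> cbox p q \<subseteq> V" if "open V" "x \<in> V" for x V
  proof -
    obtain a b where ab: "cbox a b \<subseteq> V" "x \<in> box a b"
      using open_contains_cbox[OF \<open>open V\<close> \<open>x \<in> V\<close>] by metis
    have "box a x \<noteq> {}" "box x b \<noteq> {}"
      using ab(2) by (auto simp: box_ne_empty mem_box)
    then obtain p q where pq: "p \<in> D" "q \<in> D" "p \<in> box a x" "q \<in> box x b"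
      using D(2)[OF open_box] by meson
    then have "x \<in> box p q" by (auto simp: mem_box)
    moreover have "cbox p q \<subseteq> cbox a b"
      using pq by (force simp: mem_box)
    ultimately show ?thesis using pq ab(1) by auto
  qed
  with D(1) show thesis by (intro that[of "D \<times> D"]) auto
qed

text \<open>Multiplying the difference quotient by the square of the increment keeps the condition trivial
  at \<open>s = x $ k\<close> and makes the set closed.\<close>

definition quotient_set ::
    "'m \<Rightarrow> (real ^ 'm \<Rightarrow> real) \<Rightarrow> real \<Rightarrow> real \<Rightarrow> real ^ 'm \<Rightarrow> real ^ 'm::finite \<Rightarrow> (real ^ 'm) set" where
  "quotient_set k h a b p q = {x \<in> cbox p q. \<forall>s\<in>{p $ k..q $ k}.
     a * (s - x $ k)\<^sup>2 \<le> (h (insert_coord k x s) - h x) * (s - x $ k) \<and>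
     (h (insert_coord k x s) - h x) * (s - x $ k) \<le> b * (s - x $ k)\<^sup>2}"

lemma insert_coord_in_cbox:
  "x \<in> cbox p q \<Longrightarrow> s \<in> {p $ k..q $ k} \<Longrightarrow> insert_coord k x s \<in> cbox p q"
  by (auto simp: mem_box_cart)

text \<open>The range of \<open>s\<close> depends on the box and not on \<open>x\<close>, so the
  quantifier over \<open>s\<close> is an intersection of closed conditions on
  \<open>x\<close>.\<close>

lemma compact_quotient_set:
  assumes h: "continuous_on (cbox p q) h"
  shows "compact (quotient_set k h a b p q)"
proof -
  have cont: "continuous_on (cbox p q) (\<lambda>x. h (insert_coord k x s))" if "s \<in> {p $ k..q $ k}" for s
    using that by (intro continuous_on_compose2[OF h] continuous_intros) (auto intro: insert_coord_in_cbox)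
  have "quotient_set k h a b p q = cbox p q \<inter> (\<Inter>s\<in>{p $ k..q $ k}.
     {x\<in>cbox p q. a * (s - x $ k)\<^sup>2 \<le> (h (insert_coord k x s) - h x) * (s - x $ k)} \<inter>
     {x\<in>cbox p q. (h (insert_coord k x s) - h x) * (s - x $ k) \<le> b * (s - x $ k)\<^sup>2})"
    by (auto simp: quotient_set_def)
  also have "compact \<dots>"
    by (intro compact_Int_closed compact_cbox closed_INT closed_Int ballI continuous_on_closed_Collect_le
        closed_cbox continuous_intros cont h)
  finally show ?thesis .
qed

text \<open>Two distinct points of one line with equal \<open>h\<close> have difference quotient 0,
  which lies outside the bounds \<open>a\<close> and \<open>b\<close>.\<close>

lemma inj_on_quotient_set:
  assumes "0 < a \<or> b < 0"
  shows "inj_on (\<lambda>y. (drop_coord k y, h y)) (quotient_set k h a b p q)"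
proof (rule inj_onI)
  fix y y' assume y: "y \<in> quotient_set k h a b p q" "y' \<in> quotient_set k h a b p q"
    and eq: "(drop_coord k y, h y) = (drop_coord k y', h y')"
  have "insert_coord k y (y' $ k) = insert_coord k (drop_coord k y) (y' $ k)" by simp
  also have "\<dots> = insert_coord k y' (y' $ k)" using eq by simp
  finally have y': "insert_coord k y (y' $ k) = y'" by simp
  have "y' $ k \<in> {p $ k..q $ k}" using y(2) by (auto simp: quotient_set_def mem_box_cart)
  then have "a * (y' $ k - y $ k)\<^sup>2 \<le> 0" "0 \<le> b * (y' $ k - y $ k)\<^sup>2"
    using y(1) eq y' unfolding quotient_set_def by fastforce+
  then have "(y' $ k - y $ k)\<^sup>2 \<le> 0"
    using assms by (auto simp: mult_le_0_iff zero_le_mult_iff)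
  then have "y' $ k = y $ k" by simp
  then show "y = y'" using y' by (metis insert_coord_nth_same)
qed

lemma quotient_bounds:
  assumes "x \<in> quotient_set k h a b p q" "s \<in> {p $ k..q $ k}" "s \<noteq> x $ k"
  shows "a \<le> (h (insert_coord k x s) - h x) / (s - x $ k)"
    and "(h (insert_coord k x s) - h x) / (s - x $ k) \<le> b"
proof -
  have *: "(h (insert_coord k x s) - h x) / (s - x $ k) =
      (h (insert_coord k x s) - h x) * (s - x $ k) / (s - x $ k)\<^sup>2"
    using assms(3) by (simp add: power2_eq_square)
  show "a \<le> (h (insert_coord k x s) - h x) / (s - x $ k)"
    "(h (insert_coord k x s) - h x) / (s - x $ k) \<le> b"
    unfolding * using assms by (auto simp: quotient_set_def pos_le_divide_eq pos_divide_le_eq)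
qed

lemma eventually_in_box_side:
  fixes x :: "real ^ 'm::finite"
  shows "x \<in> box p q \<Longrightarrow> \<forall>\<^sub>F s in at (x $ k). s \<in> {p $ k..q $ k} \<and> s \<noteq> x $ k"
  by (rule eventually_mono[OF eventually_at_in_open[of "{p $ k<..<q $ k}" "x $ k"]])
    (auto simp: mem_box_cart)

lemma quotient_bounds_eventually:
  assumes "x \<in> quotient_set k h a b p q" "x \<in> box p q"
  shows "\<forall>\<^sub>F s in at (x $ k). a \<le> (h (insert_coord k x s) - h x) / (s - x $ k) \<and>
           (h (insert_coord k x s) - h x) / (s - x $ k) \<le> b"
  using eventually_in_box_side[OF assms(2)] by eventually_elim (use quotient_bounds[OF assms(1)] in blast)

lemma partial_deriv_bounds:
  assumes x: "x \<in> quotient_set k h a b p q" "x \<in> box p q"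
    and d: "((\<lambda>s. h (insert_coord k x s)) has_real_derivative d) (at (x $ k))"
  shows "a \<le> d" "d \<le> b"
proof -
  have lim: "((\<lambda>s. (h (insert_coord k x s) - h x) / (s - x $ k)) \<longlongrightarrow> d) (at (x $ k))"
    using d by (simp add: has_field_derivative_iff)
  show "a \<le> d"
    using quotient_bounds_eventually[OF x] by (intro tendsto_lowerbound[OF lim]) (auto elim: eventually_mono)
  show "d \<le> b"
    using quotient_bounds_eventually[OF x] by (intro tendsto_upperbound[OF lim]) (auto elim: eventually_mono)
qed

text \<open>A counterpart to \<open>partial_deriv_bounds\<close>. Strict inequalities for
  \<open>d\<close> are required here, because the quotients near \<open>x\<close> may lie on either
  side of their limit.\<close>

lemma in_quotient_set:
  assumes d: "((\<lambda>s. h (insert_coord k x s)) has_real_derivative d) (at (x $ k))" and "a < d" "d < b"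
    and U: "open U" "x \<in> U"
    and R: "\<And>x V. open V \<Longrightarrow> x \<in> V \<Longrightarrow> \<exists>(p, q)\<in>R. x \<in> box p q \<and> cbox p q \<subseteq> V"
  shows "\<exists>(p, q)\<in>R. cbox p q \<subseteq> U \<and> x \<in> box p q \<and> x \<in> quotient_set k h a b p q"
proof -
  have lim: "((\<lambda>s. (h (insert_coord k x s) - h x) / (s - x $ k)) \<longlongrightarrow> d) (at (x $ k))"
    using d by (simp add: has_field_derivative_iff)
  have "\<forall>\<^sub>F s in at (x $ k). a < (h (insert_coord k x s) - h x) / (s - x $ k) \<and>
      (h (insert_coord k x s) - h x) / (s - x $ k) < b"
    using order_tendstoD[OF lim] assms(2,3) by (auto intro: eventually_conj)
  then obtain \<delta> where \<delta>: "\<delta> > 0" "\<And>s. s \<noteq> x $ k \<Longrightarrow> dist s (x $ k) < \<delta> \<Longrightarrow>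
      a < (h (insert_coord k x s) - h x) / (s - x $ k) \<and> (h (insert_coord k x s) - h x) / (s - x $ k) < b"
    unfolding eventually_at by blast
  have "\<exists>(p, q)\<in>R. x \<in> box p q \<and> cbox p q \<subseteq> U \<inter> ball x \<delta>"
    using U \<delta>(1) by (intro R) auto
  then obtain p q where pq: "(p, q) \<in> R" "x \<in> box p q" "cbox p q \<subseteq> U" "cbox p q \<subseteq> ball x \<delta>" by auto
  have xc: "x \<in> cbox p q" using pq(2) box_subset_cbox by blast
  have "x \<in> quotient_set k h a b p q"
    unfolding quotient_set_def
  proof (intro CollectI conjI ballI xc)
    fix s assume s: "s \<in> {p $ k..q $ k}"
    have "insert_coord k x s \<in> ball x \<delta>" using insert_coord_in_cbox[OF xc s] pq(4) by blast
    then have "dist (insert_coord k x s $ k) (x $ k) < \<delta>"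
      using dist_vec_nth_le[of "insert_coord k x s" k x] by (simp add: dist_commute)
    then have *: "dist s (x $ k) < \<delta>" by simp
    have "a * (s - x $ k)\<^sup>2 \<le> (h (insert_coord k x s) - h x) * (s - x $ k) \<and>
          (h (insert_coord k x s) - h x) * (s - x $ k) \<le> b * (s - x $ k)\<^sup>2"
    proof (cases "s = x $ k")
      case False
      have eq: "(h (insert_coord k x s) - h x) * (s - x $ k) =
         (h (insert_coord k x s) - h x) / (s - x $ k) * (s - x $ k)\<^sup>2"
        using False by (simp add: power2_eq_square)
      show ?thesis
        unfolding eq using \<delta>(2)[OF False *] by (intro conjI mult_right_mono) auto
    qed simp
    then show "a * (s - x $ k)\<^sup>2 \<le> (h (insert_coord k x s) - h x) * (s - x $ k)"
          "(h (insert_coord k x s) - h x) * (s - x $ k) \<le> b * (s - x $ k)\<^sup>2" by auto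
  qed
  with pq show ?thesis by blast
qed

text \<open>A Cauchy criterion: arbitrarily narrow eventual bounds for the difference quotients
  force a limit, even though the limit is not given in advance.\<close>

lemma partially_differentiable_if_quotients:
  assumes *: "\<And>\<epsilon>. 0 < \<epsilon> \<Longrightarrow> \<exists>a b p q. b - a < \<epsilon> \<and> x \<in> box p q \<and> x \<in> quotient_set k h a b p q"
  shows "(\<lambda>s. h (insert_coord k x s)) field_differentiable (at (x $ k))"
proof -
  define Q where "Q s = (h (insert_coord k x s) - h x) / (s - x $ k)" for s
  define P where "P a b \<longleftrightarrow> (\<forall>\<^sub>F s in at (x $ k). a \<le> Q s \<and> Q s \<le> b)" for a b
  have PP: "a \<le> b'" if "P a b" "P a' b'" for a b a' b'
  proof -
    have "\<forall>\<^sub>F s in at (x $ k). a \<le> b'" using that unfolding P_def by eventually_elim auto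
    then show ?thesis by simp
  qed
  have ex: "\<exists>a b. b - a < \<epsilon> \<and> P a b" if "0 < \<epsilon>" for \<epsilon>
    using *[OF that] quotient_bounds_eventually unfolding P_def Q_def by blast
  \<comment> \<open>By \<open>PP\<close> every lower bound lies below every upper bound, so the
    supremum of the lower bounds falls between each matching pair.\<close>
  define d where "d = Sup {a. \<exists>b. P a b}"
  obtain a0 b0 where P0: "P a0 b0" using ex[of 1] by auto
  have d: "a \<le> d \<and> d \<le> b" if "P a b" for a b
    unfolding d_def
  proof
    show "a \<le> Sup {a. \<exists>b. P a b}" using that PP by (intro cSup_upper) (auto intro!: bdd_aboveI[of _ b])
    show "Sup {a. \<exists>b. P a b} \<le> b" using that PP by (intro cSup_least) auto
  qed
  have "(Q \<longlongrightarrow> d) (at (x $ k))"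
  proof (rule tendstoI)
    fix \<epsilon> :: real assume "0 < \<epsilon>"
    from ex[OF this] obtain a b where ab: "b - a < \<epsilon>" "P a b" by blast
    show "\<forall>\<^sub>F s in at (x $ k). dist (Q s) d < \<epsilon>"
      using ab(2)[unfolded P_def] by eventually_elim (use d[OF ab(2)] ab(1) in \<open>auto simp: dist_real_def\<close>)
  qed
  then have "((\<lambda>s. h (insert_coord k x s)) has_real_derivative d) (at (x $ k))"
    by (simp add: has_field_derivative_iff Q_def[abs_def])
  then show ?thesis by (auto simp: field_differentiable_def)
qed

text \<open>This rests on the default value 0 in \<open>partial_deriv\<close>: a nonzero value
  certifies differentiability.\<close>

lemma has_derivative_partial_deriv:
  assumes "partial_deriv k h x \<noteq> 0"
  shows "((\<lambda>s. h (insert_coord k x s)) has_real_derivative partial_deriv k h x) (at (x $ k))"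
  using assms by (auto simp: partial_deriv_def DERIV_deriv_iff_field_differentiable split: if_splits)

text \<open>Both the set where the partial derivative exists and its superlevel sets are built by
  countable operations from quotient sets with rational bounds, each of them compact.\<close>

lemma borel_measurable_partial_deriv:
  fixes h :: "real ^ 'm::finite \<Rightarrow> real"
  assumes U: "open U" and h: "continuous_on U h"
  shows "(\<lambda>x. indicat_real U x * partial_deriv k h x) \<in> borel_measurable borel"
proof -
  obtain R :: "((real ^ 'm) \<times> (real ^ 'm)) set" where R: "countable R"
    "\<And>x V. open V \<Longrightarrow> x \<in> V \<Longrightarrow> \<exists>(p, q)\<in>R. x \<in> box p q \<and> cbox p q \<subseteq> V"
    using countable_box_basis by blast
  define I where "I = {(a :: real, b :: real, p, q). a \<in> \<rat> \<and> b \<in> \<rat> \<and> (p, q) \<in> R \<and> cbox p q \<subseteq> U}"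
  have "countable ((\<rat> :: real set) \<times> (\<rat> :: real set) \<times> R)" using R(1) countable_rat by auto
  then have I: "countable I" by (rule countable_subset[rotated]) (auto simp: I_def)
  define E where "E = (\<lambda>(a, b, p, q). quotient_set k h a b p q \<inter> box p q)"
  have E: "E i \<in> sets borel" if "i \<in> I" for i
  proof -
    obtain a b p q where i: "i = (a, b, p, q)" using prod_cases4 by blast
    have "compact (quotient_set k h a b p q)"
      using that h by (intro compact_quotient_set) (auto simp: I_def i intro: continuous_on_subset)
    then show ?thesis
      unfolding E_def i by (auto intro: sets.Int borel_compact borel_open open_box)
  qed
  define D where "D = {x\<in>U. (\<lambda>s. h (insert_coord k x s)) field_differentiable (at (x $ k))}"
  have deriv: "((\<lambda>s. h (insert_coord k x s)) has_real_derivative partial_deriv k h x) (at (x $ k))"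
    if "x \<in> D" for x
    using that by (auto simp: D_def partial_deriv_def DERIV_deriv_iff_field_differentiable)
  \<comment> \<open>One choice of rational bounds serves two ends: a narrow gap certifies
    differentiability, and a lower bound above \<open>c\<close> certifies that the derivative
    exceeds \<open>c\<close>.\<close>
  have in_E: "\<exists>i\<in>I. x \<in> E i \<and> c < fst i \<and> fst (snd i) - fst i < \<epsilon>"
    if x: "x \<in> D" and c: "c < partial_deriv k h x" and "0 < \<epsilon>" for x c \<epsilon>
  proof -
    let ?d = "partial_deriv k h x"
    have "max c (?d - \<epsilon>/2) < ?d" using c \<open>0 < \<epsilon>\<close> by simp
    then obtain a where a: "a \<in> \<rat>" "max c (?d - \<epsilon>/2) < a" "a < ?d" using Rats_dense_in_real by blast
    obtain b where b: "b \<in> \<rat>" "?d < b" "b < ?d + \<epsilon>/2"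
      using Rats_dense_in_real[of ?d "?d + \<epsilon>/2"] \<open>0 < \<epsilon>\<close> by auto
    have "x \<in> U" using x by (simp add: D_def)
    from in_quotient_set[OF deriv[OF x] a(3) b(2) U this R(2)]
    obtain p q where "(p, q) \<in> R" "cbox p q \<subseteq> U" "x \<in> box p q" "x \<in> quotient_set k h a b p q" by auto
    then show ?thesis using a b by (intro bexI[of _ "(a, b, p, q)"]) (auto simp: I_def E_def)
  qed
  have "D = (\<Inter>n. \<Union>i\<in>{i\<in>I. fst (snd i) - fst i < 1 / real (Suc n)}. E i)"
  proof (intro set_eqI iffI)
    fix x assume x: "x \<in> D"
    have "\<exists>i\<in>I. x \<in> E i \<and> fst (snd i) - fst i < 1 / real (Suc n)" for n
      using in_E[OF x, of "partial_deriv k h x - 1" "1 / real (Suc n)"] by auto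
    then show "x \<in> (\<Inter>n. \<Union>i\<in>{i\<in>I. fst (snd i) - fst i < 1 / real (Suc n)}. E i)" by blast
  next
    fix x assume x: "x \<in> (\<Inter>n. \<Union>i\<in>{i\<in>I. fst (snd i) - fst i < 1 / real (Suc n)}. E i)"
    then have "x \<in> U" by (force simp: I_def E_def quotient_set_def)
    moreover have "\<exists>a b p q. b - a < \<epsilon> \<and> x \<in> box p q \<and> x \<in> quotient_set k h a b p q" if "0 < \<epsilon>" for \<epsilon>
    proof -
      obtain n where n: "1 / real (Suc n) < \<epsilon>" using \<open>0 < \<epsilon>\<close> nat_approx_posE by blast
      have "\<exists>i\<in>I. fst (snd i) - fst i < 1 / real (Suc n) \<and> x \<in> E i" using x by blast
      then obtain a b p q where "(a, b, p, q) \<in> I" "b - a < 1 / real (Suc n)" "x \<in> E (a, b, p, q)"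
        by (metis fst_conv prod_cases4 snd_conv)
      then show ?thesis
        using n by (intro exI[of _ a] exI[of _ b] exI[of _ p] exI[of _ q]) (auto simp: E_def)
    qed
    ultimately show "x \<in> D" unfolding D_def by (auto intro: partially_differentiable_if_quotients)
  qed
  also have "\<dots> \<in> sets borel"
    using I E by (intro sets.countable_INT sets.countable_UN') (auto intro: countable_subset)
  finally have D[measurable]: "D \<in> sets borel" .
  have gt[measurable]: "{x\<in>D. c < partial_deriv k h x} \<in> sets borel" for c
  proof -
    have "{x\<in>D. c < partial_deriv k h x} = D \<inter> (\<Union>i\<in>{i\<in>I. c < fst i}. E i)"
    proof (intro set_eqI iffI)
      fix x assume "x \<in> {x\<in>D. c < partial_deriv k h x}"
      then have x: "x \<in> D" "c < partial_deriv k h x" by auto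
      show "x \<in> D \<inter> (\<Union>i\<in>{i\<in>I. c < fst i}. E i)" using in_E[OF x zero_less_one] x(1) by blast
    next
      fix x assume x: "x \<in> D \<inter> (\<Union>i\<in>{i\<in>I. c < fst i}. E i)"
      then obtain a b p q where "c < a" "x \<in> E (a, b, p, q)" by force
      then have "a \<le> partial_deriv k h x"
        using partial_deriv_bounds[OF _ _ deriv] x by (auto simp: E_def)
      then show "x \<in> {x\<in>D. c < partial_deriv k h x}" using x \<open>c < a\<close> by auto
    qed
    also have "\<dots> \<in> sets borel"
      using I E by (intro sets.Int D sets.countable_UN') (auto intro: countable_subset)
    finally show ?thesis .
  qed
  show ?thesis
  proof (rule borel_measurableI_greater)
    fix c :: real
    \<comment> \<open>Off \<open>D\<close> the product is 0, which exceeds \<open>c\<close> exactly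
      for negative \<open>c\<close>.\<close>
    have "{x\<in>space borel. c < indicat_real U x * partial_deriv k h x} =
       {x\<in>D. c < partial_deriv k h x} \<union> (if c < 0 then - D else {})"
      by (auto simp: D_def indicator_def partial_deriv_def)
    then show "{x\<in>space borel. c < indicat_real U x * partial_deriv k h x} \<in> sets borel" by auto
  qed
qed

text \<open>A continuous injection on a compact set has a continuous inverse, so the image of a
  Borel subset is the preimage under that inverse and hence Borel. The first component of
  \<open>p\<close> carries an arbitrary \<open>k\<close>-th coordinate, so the image is finally
  pulled back along \<open>drop_coord\<close>.\<close>

lemma sets_level_image:
  fixes h :: "real ^ 'm::finite \<Rightarrow> real"
  assumes E: "compact E" and inj: "inj_on (\<lambda>y. (drop_coord k y, h y)) E" and h: "continuous_on E h"
    and D: "D \<in> sets borel" "D \<subseteq> E"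
  shows "{p. \<exists>s. insert_coord k (fst p) s \<in> D \<and> h (insert_coord k (fst p) s) = snd p} \<in> sets borel"
proof -
  define \<Phi> where "\<Phi> = (\<lambda>y. (drop_coord k y, h y))"
  define \<Psi> where "\<Psi> = the_inv_into E \<Phi>"
  have \<Phi>: "continuous_on E \<Phi>"
    unfolding \<Phi>_def by (intro continuous_on_Pair continuous_on_drop_coord h)
  have cE: "compact (\<Phi> ` E)" using \<Phi> E by (rule compact_continuous_image)
  have \<Psi>: "continuous_on (\<Phi> ` E) \<Psi>"
    unfolding \<Psi>_def using continuous_on_inv_into[OF \<Phi> E] inj by (simp add: \<Phi>_def)
  have "\<Psi> -` D \<inter> space (restrict_space borel (\<Phi> ` E)) \<in> sets (restrict_space borel (\<Phi> ` E))"
    using borel_measurable_continuous_on_restrict[OF \<Psi>] D(1) by (rule measurable_sets)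
  then have "\<Psi> -` D \<inter> \<Phi> ` E \<in> sets borel"
    using borel_compact[OF cE] by (simp add: sets_restrict_space_iff space_restrict_space)
  also have "\<Psi> -` D \<inter> \<Phi> ` E = \<Phi> ` D"
    using D(2) inj the_inv_into_f_f[of \<Phi> E] by (fastforce simp: \<Psi>_def \<Phi>_def[symmetric])
  finally have [measurable]: "\<Phi> ` D \<in> sets borel" .
  have "{p. \<exists>s. insert_coord k (fst p) s \<in> D \<and> h (insert_coord k (fst p) s) = snd p} =
    (\<lambda>p. (drop_coord k (fst p), snd p)) -` (\<Phi> ` D) \<inter> space borel"
  proof (intro set_eqI iffI)
    fix p assume "p \<in> {p. \<exists>s. insert_coord k (fst p) s \<in> D \<and> h (insert_coord k (fst p) s) = snd p}"
    then obtain s where "insert_coord k (fst p) s \<in> D" "h (insert_coord k (fst p) s) = snd p" by auto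
    then show "p \<in> (\<lambda>p. (drop_coord k (fst p), snd p)) -` (\<Phi> ` D) \<inter> space borel"
      by (auto simp: \<Phi>_def drop_coord_def intro!: image_eqI[of _ _ "insert_coord k (fst p) s"])
  next
    fix p assume "p \<in> (\<lambda>p. (drop_coord k (fst p), snd p)) -` (\<Phi> ` D) \<inter> space borel"
    then obtain y where y: "y \<in> D" "drop_coord k (fst p) = drop_coord k y" "snd p = h y"
      by (auto simp: \<Phi>_def)
    have "insert_coord k (fst p) (y $ k) = insert_coord k (drop_coord k (fst p)) (y $ k)" by simp
    also have "\<dots> = y" unfolding y(2) by simp
    finally show "p \<in> {p. \<exists>s. insert_coord k (fst p) s \<in> D \<and> h (insert_coord k (fst p) s) = snd p}"
      using y by (intro CollectI exI[of _ "y $ k"]) auto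
  qed
  also have "\<dots> \<in> sets borel"
    by (rule measurable_sets[of _ borel borel])
      (auto intro!: borel_measurable_continuous_onI continuous_intros continuous_on_compose2[OF continuous_on_drop_coord])
  finally show ?thesis .
qed

subsection \<open>The level coordinate\<close>

lemma is_level_coord_drop_coord: "is_level_coord k \<Omega> h (drop_coord k z) = is_level_coord k \<Omega> h z"
  by (simp add: is_level_coord_def fun_eq_iff)

lemma at_level_drop_coord [simp]: "at_level k \<Omega> h \<phi> (drop_coord k z) = at_level k \<Omega> h \<phi> z"
  by (simp add: at_level_def level_coord_def is_level_coord_drop_coord fun_eq_iff)

lemma at_level_insert_coord [simp]: "at_level k \<Omega> h \<phi> (insert_coord k z s) = at_level k \<Omega> h \<phi> z"
proof -
  have "drop_coord k (insert_coord k z s) = drop_coord k z" by (simp add: drop_coord_def)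
  then show ?thesis by (metis at_level_drop_coord)
qed

text \<open>A point of the Borel set \<Omega> may have no box around it inside \<Omega>, while a
  partial derivative compares values on both sides of the point. The open set \<open>U\<close>
  supplies room for these boxes.\<close>

locale level_coordinate =
  fixes k :: "'m::finite" and \<Omega> U :: "(real ^ 'm) set" and h :: "real ^ 'm \<Rightarrow> real"
  assumes Omega_borel: "\<Omega> \<in> sets borel"
    and open_U: "open U" and Omega_subset: "\<Omega> \<subseteq> U"
    and cont_h: "continuous_on U h"
    and inj: "inj_on (\<lambda>x. insert_coord k x (h x)) \<Omega>"
begin

declare Omega_borel [measurable]

lemma level_unique:
  assumes "insert_coord k z s \<in> \<Omega>" "insert_coord k z s' \<in> \<Omega>"
    and "h (insert_coord k z s) = h (insert_coord k z s')"
  shows "s = s'"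
proof -
  have "insert_coord k z s = insert_coord k z s'"
    using inj_onD[OF inj _ assms(1,2)] assms(3) by simp
  then show ?thesis by (metis insert_coord_nth)
qed

lemma at_level_eq:
  assumes "insert_coord k z s \<in> \<Omega>"
  shows "at_level k \<Omega> h \<phi> z (h (insert_coord k z s)) = \<phi> (insert_coord k z s)"
proof -
  have "level_coord k \<Omega> h z (h (insert_coord k z s)) = s"
    unfolding level_coord_def is_level_coord_def using assms level_unique by blast
  then show ?thesis using assms by (auto simp: at_level_def is_level_coord_def)
qed

lemma at_level_eq_0:
  assumes "\<And>s. insert_coord k z s \<in> \<Omega> \<Longrightarrow> h (insert_coord k z s) = t \<Longrightarrow> \<phi> (insert_coord k z s) = 0"
  shows "at_level k \<Omega> h \<phi> z t = 0"
proof (cases "\<exists>s. is_level_coord k \<Omega> h z t s")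
  case True
  then obtain s where "insert_coord k z s \<in> \<Omega>" "h (insert_coord k z s) = t"
    by (auto simp: is_level_coord_def)
  then show ?thesis using at_level_eq[of z s \<phi>] assms by auto
qed (simp add: at_level_def)

lemma measurable_indicator_h [measurable]: "(\<lambda>x. indicat_real \<Omega> x * h x) \<in> borel_measurable borel"
  using borel_measurable_continuous_on_indicator[OF Omega_borel continuous_on_subset[OF cont_h Omega_subset]]
  by simp

lemma measurable_indicator_partial_deriv [measurable]:
  "(\<lambda>x. indicat_real \<Omega> x * partial_deriv k h x) \<in> borel_measurable borel"
proof -
  have "(\<lambda>x. indicat_real \<Omega> x * partial_deriv k h x) =
      (\<lambda>x. indicat_real \<Omega> x * (indicat_real U x * partial_deriv k h x))"
    using Omega_subset by (auto simp: indicator_def fun_eq_iff)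
  also have "\<dots> \<in> borel_measurable borel"
    using borel_measurable_partial_deriv[OF open_U cont_h] by measurable
  finally show ?thesis .
qed

lemma measurable_quotient_J_tilde:
  assumes [measurable]: "\<gamma> \<in> borel_measurable borel"
  shows "(\<lambda>x. indicat_real \<Omega> x * (\<gamma> x / J_tilde k h x)) \<in> borel_measurable borel"
proof -
  have "(\<lambda>x. indicat_real \<Omega> x * (\<gamma> x / J_tilde k h x)) =
      (\<lambda>x. indicat_real \<Omega> x * (\<gamma> x / \<bar>indicat_real \<Omega> x * partial_deriv k h x\<bar>))"
    by (auto simp: indicator_def fun_eq_iff J_tilde_def)
  also have "\<dots> \<in> borel_measurable borel" by measurable
  finally show ?thesis .
qed

text \<open>The value 0 also stands for a missing solution, so preimages are computed directly only
  for sets avoiding 0; a set containing 0 is treated through its complement. For the former, the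
  solution point lies where \<phi> is nonzero and thus in one of the countably many quotient
  sets.\<close>

lemma measurable_at_level:
  assumes \<phi>: "(\<lambda>x. indicat_real \<Omega> x * \<phi> x) \<in> borel_measurable borel"
    and nz: "\<And>x. x \<in> \<Omega> \<Longrightarrow> \<phi> x \<noteq> 0 \<Longrightarrow> partial_deriv k h x \<noteq> 0"
  shows "(\<lambda>p. at_level k \<Omega> h \<phi> (fst p) (snd p)) \<in> borel_measurable borel"
proof -
  obtain R :: "((real ^ 'm) \<times> (real ^ 'm)) set" where R: "countable R"
    "\<And>x V. open V \<Longrightarrow> x \<in> V \<Longrightarrow> \<exists>(p, q)\<in>R. x \<in> box p q \<and> cbox p q \<subseteq> V"
    using countable_box_basis by blast
  define I where "I = {(a :: real, b :: real, p, q). a \<in> \<rat> \<and> b \<in> \<rat> \<and> (0 < a \<or> b < 0) \<and> (p, q) \<in> R \<and> cbox p q \<subseteq> U}"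
  have "countable ((\<rat> :: real set) \<times> (\<rat> :: real set) \<times> R)" using R(1) countable_rat by auto
  then have I: "countable I" by (rule countable_subset[rotated]) (auto simp: I_def)
  define E where "E = (\<lambda>(a, b, p, q). quotient_set k h a b p q)"
  have cover: "\<exists>i\<in>I. x \<in> E i" if "x \<in> \<Omega>" "\<phi> x \<noteq> 0" for x
  proof -
    let ?d = "partial_deriv k h x"
    have "?d \<noteq> 0" using nz that by blast
    \<comment> \<open>The window around \<open>?d\<close> is cut off at 0, so that the rational
      bounds have the same sign as \<open>?d\<close> on the side facing 0.\<close>
    then have "max (?d - 1) (if 0 < ?d then 0 else ?d - 1) < ?d"
      "?d < min (?d + 1) (if ?d < 0 then 0 else ?d + 1)" by auto
    then obtain a b where ab: "a \<in> \<rat>" "max (?d - 1) (if 0 < ?d then 0 else ?d - 1) < a" "a < ?d"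
      "b \<in> \<rat>" "?d < b" "b < min (?d + 1) (if ?d < 0 then 0 else ?d + 1)"
      using Rats_dense_in_real by meson
    have "0 < a \<or> b < 0" using ab \<open>?d \<noteq> 0\<close> by (auto split: if_splits)
    moreover have "x \<in> U" using that Omega_subset by blast
    ultimately show ?thesis
      using in_quotient_set[OF has_derivative_partial_deriv[OF \<open>?d \<noteq> 0\<close>] ab(3,5) open_U _ R(2)] ab
      by (force simp: I_def E_def)
  qed
  have main: "{p. at_level k \<Omega> h \<phi> (fst p) (snd p) \<in> S} \<in> sets borel" if S: "S \<in> sets borel" "0 \<notin> S" for S
  proof -
    define D where "D = (\<lambda>x. indicat_real \<Omega> x * \<phi> x) -` S \<inter> space borel"
    have D: "D \<in> sets borel" unfolding D_def using \<phi> S(1) by (rule measurable_sets)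
    have D_eq: "x \<in> D \<longleftrightarrow> x \<in> \<Omega> \<and> \<phi> x \<in> S" for x
      using S(2) by (auto simp: D_def indicator_def)
    have "{p. at_level k \<Omega> h \<phi> (fst p) (snd p) \<in> S} =
      (\<Union>i\<in>I. {p. \<exists>s. insert_coord k (fst p) s \<in> D \<inter> E i \<and> h (insert_coord k (fst p) s) = snd p})"
    proof (intro set_eqI iffI)
      fix p assume p: "p \<in> {p. at_level k \<Omega> h \<phi> (fst p) (snd p) \<in> S}"
      then obtain s where s: "insert_coord k (fst p) s \<in> \<Omega>" "h (insert_coord k (fst p) s) = snd p"
        using S(2) by (auto simp: at_level_def is_level_coord_def split: if_splits)
      have \<phi>S: "\<phi> (insert_coord k (fst p) s) \<in> S" using p at_level_eq[OF s(1), of \<phi>] s(2) by simp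
      then obtain i where "i \<in> I" "insert_coord k (fst p) s \<in> E i" using cover[OF s(1)] S(2) by metis
      then show "p \<in> (\<Union>i\<in>I. {p. \<exists>s. insert_coord k (fst p) s \<in> D \<inter> E i \<and> h (insert_coord k (fst p) s) = snd p})"
        using s \<phi>S by (auto simp: D_eq)
    next
      fix p assume "p \<in> (\<Union>i\<in>I. {p. \<exists>s. insert_coord k (fst p) s \<in> D \<inter> E i \<and> h (insert_coord k (fst p) s) = snd p})"
      then obtain s where s: "insert_coord k (fst p) s \<in> D" "h (insert_coord k (fst p) s) = snd p" by blast
      then show "p \<in> {p. at_level k \<Omega> h \<phi> (fst p) (snd p) \<in> S}"
        using at_level_eq[of "fst p" s \<phi>] by (simp add: D_eq)
    qed
    also have "\<dots> \<in> sets borel"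
    proof (rule sets.countable_UN''[OF I])
      fix i assume i: "i \<in> I"
      obtain a b p q where i_eq: "i = (a, b, p, q)" using prod_cases4 by blast
      have h: "continuous_on (cbox p q) h" and ab: "0 < a \<or> b < 0"
        using i continuous_on_subset[OF cont_h] by (auto simp: I_def i_eq)
      have "E i \<subseteq> cbox p q" by (auto simp: E_def i_eq quotient_set_def)
      have cE: "compact (E i)" unfolding E_def i_eq using compact_quotient_set[OF h] by simp
      have "D \<inter> E i \<in> sets borel" using D borel_compact[OF cE] by blast
      moreover have "inj_on (\<lambda>y. (drop_coord k y, h y)) (E i)"
        unfolding E_def i_eq using inj_on_quotient_set[OF ab] by simp
      ultimately show "{p. \<exists>s. insert_coord k (fst p) s \<in> D \<inter> E i \<and> h (insert_coord k (fst p) s) = snd p}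
          \<in> sets borel"
        using cE continuous_on_subset[OF h \<open>E i \<subseteq> cbox p q\<close>] by (intro sets_level_image[of "E i"]) auto
    qed
    finally show ?thesis .
  qed
  show ?thesis
  proof (rule measurableI)
    fix S :: "real set" assume S: "S \<in> sets borel"
    have "(\<lambda>p. at_level k \<Omega> h \<phi> (fst p) (snd p)) -` S \<inter> space borel =
      (if 0 \<in> S then - {p. at_level k \<Omega> h \<phi> (fst p) (snd p) \<in> - S}
       else {p. at_level k \<Omega> h \<phi> (fst p) (snd p) \<in> S})" by auto
    then show "(\<lambda>p. at_level k \<Omega> h \<phi> (fst p) (snd p)) -` S \<inter> space borel \<in> sets borel"
      using main[of S] main[of "- S"] S by (auto simp: borel_comp)
  qed simp
qed

lemma measurable_at_level_quotient:
  assumes "\<gamma> \<in> borel_measurable borel"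
  shows "(\<lambda>p. at_level k \<Omega> h (\<lambda>x. \<gamma> x / J_tilde k h x) (fst p) (snd p)) \<in> borel_measurable borel"
  using measurable_quotient_J_tilde[OF assms]
  by (rule measurable_at_level) (auto simp: J_tilde_def)

lemma measurable_at_level_quotient' [measurable (raw)]:
  assumes "\<gamma> \<in> borel_measurable borel" "u \<in> M \<rightarrow>\<^sub>M borel" "v \<in> M \<rightarrow>\<^sub>M borel"
  shows "(\<lambda>w. at_level k \<Omega> h (\<lambda>x. \<gamma> x / J_tilde k h x) (u w) (v w)) \<in> borel_measurable M"
  using measurable_compose[OF measurable_Pair[OF assms(2,3), unfolded borel_prod]
      measurable_at_level_quotient[OF assms(1)]] by simp

section \<open>One-dimensional change of variables along a line\<close>

definition regular_slice :: "real ^ 'm \<Rightarrow> real set \<Rightarrow> real set" where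
  "regular_slice x T = {s. insert_coord k x s \<in> \<Omega> \<and> partial_deriv k h (insert_coord k x s) \<noteq> 0 \<and>
     h (insert_coord k x s) \<in> T}"

lemma sets_regular_slice [measurable]:
  assumes [measurable]: "T \<in> sets borel"
  shows "regular_slice x T \<in> sets borel"
proof -
  have "regular_slice x T = {s. insert_coord k x s \<in> \<Omega> \<and>
     indicat_real \<Omega> (insert_coord k x s) * partial_deriv k h (insert_coord k x s) \<noteq> 0 \<and>
     indicat_real \<Omega> (insert_coord k x s) * h (insert_coord k x s) \<in> T}"
    by (auto simp: regular_slice_def indicator_def)
  also have "\<dots> \<in> sets borel"
    using measurable_compose[OF _ measurable_indicator_partial_deriv, of "insert_coord k x"]
      measurable_compose[OF _ measurable_indicator_h, of "insert_coord k x"] by measurable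
  finally show ?thesis .
qed

text \<open>The factor produced by the substitution cancels the denominator \<open>J_tilde\<close>.
  Integrability is stated as an equivalence so that the equality of integrals holds unconditionally:
  if one side fails to be integrable, so does the other, and both integrals are 0 by
  convention.\<close>

lemma change_of_variables_at_level:
  fixes x :: "real ^ 'm" and T :: "real set" and \<gamma> :: "real ^ 'm \<Rightarrow> real"
  assumes [measurable]: "\<gamma> \<in> borel_measurable borel" "T \<in> sets borel"
  defines "\<eta> \<equiv> at_level k \<Omega> h (\<lambda>y. \<gamma> y / J_tilde k h y) x"
  shows "set_integrable lborel T \<eta> \<longleftrightarrow> set_integrable lborel (regular_slice x T) (\<lambda>s. \<gamma> (insert_coord k x s))"
      (is "?A \<longleftrightarrow> ?B")
    and "(LINT t:T|lborel. \<eta> t) = (LINT s:regular_slice x T|lborel. \<gamma> (insert_coord k x s))"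
proof -
  let ?S = "regular_slice x T" and ?g = "\<lambda>s. h (insert_coord k x s)"
  have [measurable]: "\<eta> \<in> borel_measurable borel" unfolding \<eta>_def by measurable
  have deriv: "(?g has_real_derivative partial_deriv k h (insert_coord k x s)) (at s within ?S)"
    if "s \<in> ?S" for s
    using has_derivative_partial_deriv[of k h "insert_coord k x s"] that
    by (auto simp: regular_slice_def intro: has_field_derivative_at_within)
  have inj': "inj_on ?g ?S" by (rule inj_onI) (auto simp: regular_slice_def intro: level_unique)
  have eq: "\<bar>partial_deriv k h (insert_coord k x s)\<bar> * \<eta> (?g s) = \<gamma> (insert_coord k x s)"
    if "s \<in> ?S" for s
    using that by (simp add: \<eta>_def regular_slice_def at_level_eq J_tilde_def)
  \<comment> \<open>A level in \<open>T\<close> that the regular slice misses has no solution, or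
    one at which \<open>J_tilde\<close> is 0. Both default values make \<eta> vanish, so the image
    may be enlarged to \<open>T\<close>.\<close>
  have outside: "\<eta> t = 0" if "t \<in> T" "t \<notin> ?g ` ?S" for t
    unfolding \<eta>_def using that by (intro at_level_eq_0) (auto simp: regular_slice_def J_tilde_def)
  have "?g ` ?S \<subseteq> T" by (auto simp: regular_slice_def)
  with outside have ind: "indicat_real (?g ` ?S) t *\<^sub>R \<eta> t = indicat_real T t *\<^sub>R \<eta> t" for t
    by (auto simp: indicator_def)
  have S_leb: "?S \<in> sets lebesgue" by simp
  have cov: "(\<lambda>s. \<gamma> (insert_coord k x s)) absolutely_integrable_on ?S \<and>
        integral ?S (\<lambda>s. \<gamma> (insert_coord k x s)) = b
     \<longleftrightarrow> \<eta> absolutely_integrable_on (?g ` ?S) \<and> integral (?g ` ?S) \<eta> = b" for b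
    using has_absolute_integral_change_of_variables_1'[OF S_leb deriv inj', of \<eta> b] eq
    by (simp cong: set_integrable_cong integral_cong)
  have A: "?A \<longleftrightarrow> \<eta> absolutely_integrable_on (?g ` ?S)"
    unfolding set_integrable_def ind by (simp add: integrable_completion)
  have B: "?B \<longleftrightarrow> (\<lambda>s. \<gamma> (insert_coord k x s)) absolutely_integrable_on ?S"
    unfolding set_integrable_def by (simp add: integrable_completion)
  show iff: "?A \<longleftrightarrow> ?B" unfolding A B using cov by blast
  show "(LINT t:T|lborel. \<eta> t) = (LINT s:?S|lborel. \<gamma> (insert_coord k x s))"
  proof (cases ?A)
    case True
    have "(LINT t:T|lborel. \<eta> t) = (LINT t:?g ` ?S|lebesgue. \<eta> t)"
      unfolding set_lebesgue_integral_def ind by (simp add: integral_completion)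
    also have "\<dots> = integral (?g ` ?S) \<eta>"
      using True A by (intro set_lebesgue_integral_eq_integral(2)) auto
    also have "\<dots> = integral ?S (\<lambda>s. \<gamma> (insert_coord k x s))"
      using cov[of "integral (?g ` ?S) \<eta>"] True A by simp
    also have "\<dots> = (LINT s:?S|lebesgue. \<gamma> (insert_coord k x s))"
      using True iff B by (intro set_lebesgue_integral_eq_integral(2)[symmetric]) auto
    also have "\<dots> = (LINT s:?S|lborel. \<gamma> (insert_coord k x s))"
      unfolding set_lebesgue_integral_def by (simp add: integral_completion)
    finally show ?thesis .
  next
    case False
    then show ?thesis
      using iff by (simp add: set_integrable_def set_lebesgue_integral_def not_integrable_integral_eq)
  qed
qed

end

subsection \<open>Densities\<close>

locale level_density = level_coordinate k \<Omega> U h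
  for k :: "'m::finite" and \<Omega> U :: "(real ^ 'm) set" and h :: "real ^ 'm \<Rightarrow> real" +
  fixes f :: "real ^ 'm \<Rightarrow> real"
  assumes f_int: "integrable lborel f" and f_nonneg: "0 \<le> f x"
    and f_outside: "x \<notin> \<Omega> \<Longrightarrow> f x = 0"
    and partial_nz: "AE y in lborel. f y \<noteq> 0 \<longrightarrow> partial_deriv k h y \<noteq> 0"
    and Omega_nonempty: "\<Omega> \<noteq> {}"
begin

abbreviation "c0 \<equiv> range_lower \<Omega> h"
abbreviation "c1 \<equiv> range_upper \<Omega> h"

lemma f_measurable [measurable]: "f \<in> borel_measurable borel" using f_int by auto

lemma range_bounds: "x \<in> \<Omega> \<Longrightarrow> c0 \<le> ereal (h x)" "x \<in> \<Omega> \<Longrightarrow> ereal (h x) \<le> c1"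
  unfolding range_lower_def range_upper_def by (auto intro: INF_lower SUP_upper)

lemma c0_le_c1: "c0 \<le> c1"
  using Omega_nonempty range_bounds order_trans by blast

text \<open>The bound is an extended real so that one computation covers the numerator, at \<xi>,
  and the denominator, at a possibly infinite \<open>c1\<close>.\<close>

definition sublevel :: "ereal \<Rightarrow> (real ^ 'm) set" where
  "sublevel b = {x\<in>\<Omega>. ereal (h x) \<le> b}"

lemma sets_sublevel [measurable]: "sublevel b \<in> sets borel"
proof -
  have "sublevel b = {x\<in>\<Omega>. ereal (indicat_real \<Omega> x * h x) \<le> b}"
    by (auto simp: sublevel_def)
  also have "\<dots> \<in> sets borel" by measurable
  finally show ?thesis .
qed

lemma sublevel_c1 [simp]: "sublevel c1 = \<Omega>"
  using range_bounds by (auto simp: sublevel_def)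

text \<open>Injectivity lets a line meet each level at most once. This reconciles open intervals of
  integration with sublevel sets, which contain their boundary level.\<close>

lemma AE_not_level:
  "AE s in lborel. \<not> (insert_coord k x s \<in> \<Omega> \<and> ereal (h (insert_coord k x s)) = e)"
proof (cases "\<exists>s. insert_coord k x s \<in> \<Omega> \<and> ereal (h (insert_coord k x s)) = e")
  case True
  then obtain s0 where "insert_coord k x s0 \<in> \<Omega>" "ereal (h (insert_coord k x s0)) = e" by blast
  then have "\<not> (insert_coord k x s \<in> \<Omega> \<and> ereal (h (insert_coord k x s)) = e)" if "s \<noteq> s0" for s
    using level_unique[of x s s0] that by auto
  then show ?thesis using AE_lborel_singleton[of s0] by (auto elim: eventually_mono)
qed auto

lemma einterval_c0_integral:
  fixes \<gamma> :: "real ^ 'm \<Rightarrow> real" and b :: ereal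
  assumes \<gamma>[measurable]: "\<gamma> \<in> borel_measurable borel"
    and supp: "AE s in lborel. \<gamma> (insert_coord k x s) \<noteq> 0 \<longrightarrow>
       insert_coord k x s \<in> \<Omega> \<and> partial_deriv k h (insert_coord k x s) \<noteq> 0"
  defines "\<eta> \<equiv> at_level k \<Omega> h (\<lambda>y. \<gamma> y / J_tilde k h y) x"
    and "\<gamma>b \<equiv> \<lambda>y. \<gamma> y * indicat_real (sublevel b) y"
  shows "set_integrable lborel (einterval c0 b) \<eta> \<longleftrightarrow> integrable lborel (\<lambda>s. \<gamma>b (insert_coord k x s))"
    and "(LINT t:einterval c0 b|lborel. \<eta> t) = (\<integral>s. \<gamma>b (insert_coord k x s) \<partial>lborel)"
proof -
  have [measurable]: "\<gamma>b \<in> borel_measurable borel" unfolding \<gamma>b_def by measurable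
  let ?S = "regular_slice x (einterval c0 b)"
  \<comment> \<open>Since \<open>c0\<close> bounds \<open>h\<close> from below on \<Omega>, only the
    upper condition remains away from the two end levels.\<close>
  have ae: "AE s in lborel. indicat_real ?S s *\<^sub>R \<gamma> (insert_coord k x s) = \<gamma>b (insert_coord k x s)"
    using supp AE_not_level[of x c0] AE_not_level[of x b]
  proof eventually_elim
    case (elim s)
    then show ?case
      using range_bounds(1)[of "insert_coord k x s"]
      by (auto simp: indicator_def regular_slice_def \<gamma>b_def sublevel_def einterval_iff)
  qed
  have "set_integrable lborel ?S (\<lambda>s. \<gamma> (insert_coord k x s)) \<longleftrightarrow> integrable lborel (\<lambda>s. \<gamma>b (insert_coord k x s))"
    unfolding set_integrable_def by (rule integrable_cong_AE) (use ae in auto)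
  then show "set_integrable lborel (einterval c0 b) \<eta> \<longleftrightarrow> integrable lborel (\<lambda>s. \<gamma>b (insert_coord k x s))"
    unfolding \<eta>_def by (subst change_of_variables_at_level) auto
  show "(LINT t:einterval c0 b|lborel. \<eta> t) = (\<integral>s. \<gamma>b (insert_coord k x s) \<partial>lborel)"
    unfolding \<eta>_def using ae
    by (subst change_of_variables_at_level(2)) (auto simp: set_lebesgue_integral_def intro!: integral_cong_AE)
qed

lemma interval_integral_lebesgue_eq:
  assumes [measurable]: "\<eta> \<in> borel_measurable borel" and "c0 \<le> b"
  shows "(LINT t=c0..b|lebesgue. \<eta> t) = (LINT t:einterval c0 b|lborel. (\<eta> t :: real))"
  using assms(2) unfolding interval_lebesgue_integral_def set_lebesgue_integral_def
  by (simp add: integral_completion)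

definition slice_mass :: "real ^ 'm \<Rightarrow> real" where
  "slice_mass x = (\<integral>s. f (insert_coord k x s) \<partial>lborel)"

definition regular_point :: "real ^ 'm \<Rightarrow> bool" where
  "regular_point x \<longleftrightarrow> integrable lborel (\<lambda>s. f (insert_coord k x s)) \<and>
     (AE s in lborel. f (insert_coord k x s) \<noteq> 0 \<longrightarrow> partial_deriv k h (insert_coord k x s) \<noteq> 0)"

lemma AE_regular_point: "AE x in slab k. regular_point x"
  using AE_integrable_slice[OF f_int, of k] AE_slices[OF partial_nz, of k]
  unfolding regular_point_def by eventually_elim simp

lemma den_integral_drop_coord [simp]: "den_integral k \<Omega> f h (drop_coord k x) = den_integral k \<Omega> f h x"
  and den_integral_insert_coord [simp]: "den_integral k \<Omega> f h (insert_coord k x s) = den_integral k \<Omega> f h x"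
  by (simp_all add: den_integral_def)

lemma num_integrand_drop_coord [simp]: "num_integrand k \<Omega> f g h (drop_coord k x) = num_integrand k \<Omega> f g h x"
  and num_integrand_insert_coord [simp]: "num_integrand k \<Omega> f g h (insert_coord k x s) = num_integrand k \<Omega> f g h x"
  by (simp_all add: num_integrand_def)

lemma w_tilde_drop_coord [simp]: "w_tilde k \<Omega> f g h (drop_coord k x) = w_tilde k \<Omega> f g h x"
  and w_tilde_insert_coord [simp]: "w_tilde k \<Omega> f g h (insert_coord k x s) = w_tilde k \<Omega> f g h x"
  by (simp_all add: w_tilde_def fun_eq_iff)

lemma nu_tilde_drop_coord [simp]: "nu_tilde k \<Omega> f g h (drop_coord k x) = nu_tilde k \<Omega> f g h x"
  by (simp add: nu_tilde_def fun_eq_iff)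

lemma measurable_num_integrand [measurable (raw)]:
  assumes [measurable]: "g \<in> borel_measurable borel" "u \<in> M \<rightarrow>\<^sub>M borel" "v \<in> M \<rightarrow>\<^sub>M borel"
  shows "(\<lambda>w. num_integrand k \<Omega> f g h (u w) (v w)) \<in> borel_measurable M"
  unfolding num_integrand_def by measurable

lemma den_integral_eq:
  "den_integral k \<Omega> f h x = (LINT t:einterval c0 c1|lborel. at_level k \<Omega> h (\<lambda>x. f x / J_tilde k h x) x t)"
  unfolding den_integral_def by (rule interval_integral_lebesgue_eq) (auto simp: c0_le_c1)

lemma den_integral_nonneg: "0 \<le> den_integral k \<Omega> f h x"
  unfolding den_integral_eq set_lebesgue_integral_def
  by (intro Bochner_Integration.integral_nonneg) (auto simp: at_level_def f_nonneg J_tilde_def)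

lemma measurable_den_integral [measurable]: "den_integral k \<Omega> f h \<in> borel_measurable borel"
  unfolding den_integral_eq[abs_def] set_lebesgue_integral_def by measurable

text \<open>At the upper end \<open>c1\<close> the sublevel set is all of \<Omega>, outside which
  \<open>f\<close> vanishes.\<close>

lemma den_integral_eq_slice_mass:
  assumes "regular_point x"
  shows "den_integral k \<Omega> f h x = slice_mass x"
proof -
  have "AE s in lborel. f (insert_coord k x s) \<noteq> 0 \<longrightarrow>
       insert_coord k x s \<in> \<Omega> \<and> partial_deriv k h (insert_coord k x s) \<noteq> 0"
    using assms using f_outside unfolding regular_point_def by (auto elim!: eventually_mono)
  from einterval_c0_integral(2)[OF f_measurable this, of c1] show ?thesis
    unfolding den_integral_eq slice_mass_def
    by (auto intro!: Bochner_Integration.integral_cong simp: f_outside indicator_def)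
qed

lemma w_tilde_eq:
  assumes [measurable]: "g \<in> borel_measurable borel" and "c0 < ereal \<xi>"
  shows "w_tilde k \<Omega> f g h x \<xi> =
     (LINT t:einterval c0 \<xi>|lborel. num_integrand k \<Omega> f g h x t) / den_integral k \<Omega> f h x"
  unfolding w_tilde_def using assms(2) by (subst interval_integral_lebesgue_eq) auto

lemma measurable_w_tilde:
  assumes [measurable]: "g \<in> borel_measurable borel" and "c0 < ereal \<xi>"
  shows "(\<lambda>x. w_tilde k \<Omega> f g h x \<xi>) \<in> borel_measurable borel"
  unfolding w_tilde_eq[OF assms] set_lebesgue_integral_def by measurable

text \<open>The integrand of \<open>alpha\<close> against Lebesgue measure. Its indicator is that of
  a subset of \<Omega>, where measurability of \<open>h\<close> is available.\<close>

definition truncated :: "(real ^ 'm \<Rightarrow> real) \<Rightarrow> real \<Rightarrow> real ^ 'm \<Rightarrow> real" where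
  "truncated g \<xi> y = g y * f y * indicat_real (sublevel (ereal \<xi>)) y"

section \<open>Integrating the conditional expectation line by line\<close>

context
  fixes g :: "real ^ 'm \<Rightarrow> real" and \<xi> :: real
  assumes g_measurable [measurable]: "g \<in> borel_measurable borel"
    and xi: "c0 < ereal \<xi>" and trunc_int: "integrable lborel (truncated g \<xi>)"
begin

text \<open>The product form needs no exception for vanishing \<open>slice_mass\<close>: there
  \<open>f\<close> is 0 almost everywhere on the line, so the right side vanishes too.\<close>

lemma AE_num_integrand_slice:
  "AE x in slab k. set_integrable lborel (einterval c0 \<xi>) (num_integrand k \<Omega> f g h x) \<and>
     w_tilde k \<Omega> f g h x \<xi> * slice_mass x = (\<integral>s. truncated g \<xi> (insert_coord k x s) \<partial>lborel)"
  using AE_regular_point AE_integrable_slice[OF trunc_int, of k]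
proof eventually_elim
  case (elim x)
  have supp: "AE s in lborel. g (insert_coord k x s) * f (insert_coord k x s) \<noteq> 0 \<longrightarrow>
       insert_coord k x s \<in> \<Omega> \<and> partial_deriv k h (insert_coord k x s) \<noteq> 0"
    using elim(1) using f_outside unfolding regular_point_def by (auto elim!: eventually_mono)
  have m: "(\<lambda>y. g y * f y) \<in> borel_measurable borel" by measurable
  note cov = einterval_c0_integral[OF m supp, of "ereal \<xi>", folded truncated_def num_integrand_def]
  have num: "(LINT t:einterval c0 \<xi>|lborel. num_integrand k \<Omega> f g h x t) =
      (\<integral>s. truncated g \<xi> (insert_coord k x s) \<partial>lborel)"
    by (rule cov(2))
  have zero: "(\<integral>s. truncated g \<xi> (insert_coord k x s) \<partial>lborel) = 0" if "slice_mass x = 0"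
  proof -
    have "AE s in lborel. f (insert_coord k x s) = 0"
      using elim(1) that f_nonneg unfolding slice_mass_def regular_point_def
      by (subst (asm) integral_nonneg_eq_0_iff_AE) auto
    then have "(\<integral>s. truncated g \<xi> (insert_coord k x s) \<partial>lborel) = (\<integral>s. 0 \<partial>(lborel :: real measure))"
      using trunc_int by (intro integral_cong_AE) (auto simp: truncated_def elim: eventually_mono)
    then show ?thesis by simp
  qed
  show ?case
    using cov(1) elim(2) zero num
    by (cases "slice_mass x = 0") (auto simp: w_tilde_eq xi den_integral_eq_slice_mass elim(1))
qed

text \<open>On each line \<open>w_tilde\<close> is constant and \<open>f\<close> is nonnegative, so
  integrating the absolute value of the product gives the absolute value of a slice integral of
  \<open>truncated g \<xi>\<close>. This secures integrability, and only then may the product itself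
  be integrated by slices.\<close>

lemma integral_w_tilde:
  shows "integrable lborel (\<lambda>y. f y * w_tilde k \<Omega> f g h y \<xi>)"
    and "(\<integral>y. f y * w_tilde k \<Omega> f g h y \<xi> \<partial>lborel) = integral\<^sup>L lborel (truncated g \<xi>)"
proof -
  interpret pair_sigma_finite "slab k" "lborel :: real measure" by (rule pair_sigma_finite_slab)
  note [measurable] = measurable_w_tilde[OF g_measurable xi]
  let ?F = "\<lambda>y. f y * w_tilde k \<Omega> f g h y \<xi>"
  have ae: "AE x in slab k. (\<integral>s. norm (?F (insert_coord k x s)) \<partial>lborel) =
        \<bar>\<integral>s. truncated g \<xi> (insert_coord k x s) \<partial>lborel\<bar>"
    using AE_num_integrand_slice
  proof eventually_elim
    case (elim x)
    have "(\<integral>s. norm (?F (insert_coord k x s)) \<partial>lborel) =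
        (\<integral>s. f (insert_coord k x s) * \<bar>w_tilde k \<Omega> f g h x \<xi>\<bar> \<partial>lborel)"
      by (intro Bochner_Integration.integral_cong refl) (simp add: abs_mult f_nonneg)
    also have "\<dots> = \<bar>w_tilde k \<Omega> f g h x \<xi> * slice_mass x\<bar>"
      unfolding slice_mass_def by (simp add: abs_mult f_nonneg)
    finally show ?case using elim by simp
  qed
  have m: "truncated g \<xi> \<in> borel_measurable borel" using trunc_int by auto
  have "integrable (slab k \<Otimes>\<^sub>M lborel) (\<lambda>p. ?F (insert_coord k (fst p) (snd p)))"
  proof (rule Fubini_integrable)
    show "integrable (slab k) (\<lambda>x. \<integral>s. norm (?F (insert_coord k (fst (x, s)) (snd (x, s)))) \<partial>lborel)"
      using integrable_abs[OF integrable_slice_integral[OF trunc_int, of k]] ae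
      by (subst integrable_cong_AE) (auto intro!: borel_measurable_integrable)
    show "AE x in slab k. integrable lborel (\<lambda>s. ?F (insert_coord k (fst (x, s)) (snd (x, s))))"
      using AE_regular_point by eventually_elim (auto simp: regular_point_def)
  qed measurable
  then show int: "integrable lborel ?F" by (subst (asm) integrable_slices_iff) auto
  have "integral\<^sup>L lborel ?F = (\<integral>x. \<integral>s. ?F (insert_coord k x s) \<partial>lborel \<partial>slab k)"
    by (rule integral_slices[symmetric, OF int])
  also have "\<dots> = (\<integral>x. \<integral>s. truncated g \<xi> (insert_coord k x s) \<partial>lborel \<partial>slab k)"
    using integrable_slice_integral[OF int, of k] integrable_slice_integral[OF trunc_int, of k] AE_num_integrand_slice
    by (intro integral_cong_AE) (auto simp: slice_mass_def mult.commute elim!: eventually_mono)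
  also have "\<dots> = integral\<^sup>L lborel (truncated g \<xi>)" by (rule integral_slices[OF trunc_int])
  finally show "integral\<^sup>L lborel ?F = integral\<^sup>L lborel (truncated g \<xi>)" .
qed

lemma AE_set_integrable_num_integrand:
  "AE y in lborel. set_integrable lborel (einterval c0 \<xi>) (num_integrand k \<Omega> f g h y)"
proof (rule AE_if_AE_slab)
  show "Measurable.pred borel (\<lambda>y. set_integrable lborel (einterval c0 \<xi>) (num_integrand k \<Omega> f g h y))"
    unfolding set_integrable_def by measurable
  show "AE x in slab k. set_integrable lborel (einterval c0 \<xi>) (num_integrand k \<Omega> f g h x)"
    using AE_num_integrand_slice by eventually_elim simp
qed simp

end

end

subsection \<open>Random vectors\<close>

locale level_sample = level_density k \<Omega> U h f + prob_space M
  for k :: "'m::finite" and \<Omega> U :: "(real ^ 'm) set" and h f :: "real ^ 'm \<Rightarrow> real" and M :: "'w measure" +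
  fixes X :: "'w \<Rightarrow> real ^ 'm"
  assumes X_distributed: "distributed M lborel X (\<lambda>x. ennreal (f x))"
begin

lemma X_measurable [measurable]: "X \<in> M \<rightarrow>\<^sub>M borel"
  using distributed_measurable[OF X_distributed] by simp

lemma AE_sample:
  assumes "AE y in lborel. f y \<noteq> 0 \<longrightarrow> P y"
  shows "AE \<omega> in M. P (X \<omega>)"
proof -
  have "AE y in density lborel (\<lambda>x. ennreal (f x)). P y"
    using assms by (subst AE_density) (auto elim!: eventually_mono)
  then have "AE y in distr M lborel X. P y"
    by (simp only: distributed_distr_eq_density[OF X_distributed])
  then show ?thesis by (rule AE_distrD[rotated]) simp
qed

lemma AE_sample_in_Omega: "AE \<omega> in M. X \<omega> \<in> \<Omega>"
  by (rule AE_sample) (use f_outside in blast)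

lemma integrable_sample_iff:
  "u \<in> borel_measurable borel \<Longrightarrow> integrable M (\<lambda>\<omega>. u (X \<omega>)) \<longleftrightarrow> integrable lborel (\<lambda>y. f y * u y)"
  using distributed_integrable[OF X_distributed, of u] f_nonneg by simp

lemma integral_sample:
  "u \<in> borel_measurable borel \<Longrightarrow> (\<integral>\<omega>. u (X \<omega>) \<partial>M) = (\<integral>y. f y * u y \<partial>lborel)"
  using distributed_integral[OF X_distributed, of u] f_nonneg by simp

lemma truncated_sample:
  assumes [measurable]: "g \<in> borel_measurable borel"
    and int: "integrable M (\<lambda>\<omega>. g (X \<omega>) * indicat_real {..\<xi>} (h (X \<omega>)))"
  shows "integrable lborel (truncated g \<xi>)" and "alpha M X g h \<xi> = integral\<^sup>L lborel (truncated g \<xi>)"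
proof -
  let ?u = "\<lambda>y. g y * indicat_real (sublevel (ereal \<xi>)) y"
  have ae: "AE \<omega> in M. g (X \<omega>) * indicat_real {..\<xi>} (h (X \<omega>)) = ?u (X \<omega>)"
    using AE_sample_in_Omega by eventually_elim (auto simp: indicator_def sublevel_def)
  have trunc: "truncated g \<xi> = (\<lambda>y. f y * ?u y)" by (auto simp: truncated_def)
  have "integrable M (\<lambda>\<omega>. ?u (X \<omega>))"
    using int ae by (subst integrable_cong_AE[symmetric]) auto
  then show "integrable lborel (truncated g \<xi>)"
    unfolding trunc by (subst (asm) integrable_sample_iff) auto
  have "alpha M X g h \<xi> = (\<integral>\<omega>. ?u (X \<omega>) \<partial>M)"
    unfolding alpha_def using int ae by (intro integral_cong_AE) auto
  also have "\<dots> = integral\<^sup>L lborel (truncated g \<xi>)"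
    unfolding trunc by (rule integral_sample) measurable
  finally show "alpha M X g h \<xi> = integral\<^sup>L lborel (truncated g \<xi>)" .
qed

lemma w_tilde_sample:
  assumes g: "g \<in> borel_measurable borel" and xi: "c0 < ereal \<xi>"
    and trunc: "integrable lborel (truncated g \<xi>)"
  shows "integrable M (\<lambda>\<omega>. w_tilde k \<Omega> f g h (X \<omega>) \<xi>)"
    and "(\<integral>\<omega>. w_tilde k \<Omega> f g h (X \<omega>) \<xi> \<partial>M) = integral\<^sup>L lborel (truncated g \<xi>)"
  using integral_w_tilde[OF g xi trunc]
  by (simp_all add: integrable_sample_iff[OF measurable_w_tilde[OF g xi]] integral_sample[OF measurable_w_tilde[OF g xi]])

section \<open>Differentiating \<open>alpha\<close>\<close>

context
  fixes g :: "real ^ 'm \<Rightarrow> real"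
  assumes g_borel [measurable]: "g \<in> borel_measurable borel"
    and alpha_integrable: "\<And>\<xi>. c0 < ereal \<xi> \<Longrightarrow> ereal \<xi> < c1 \<Longrightarrow>
           integrable M (\<lambda>\<omega>. g (X \<omega>) * indicat_real {..\<xi>} (h (X \<omega>)))"
begin

lemma alpha_eq_w_tilde:
  assumes "c0 < ereal \<xi>" "ereal \<xi> < c1"
  shows "integrable M (\<lambda>\<omega>. w_tilde k \<Omega> f g h (X \<omega>) \<xi>)"
    and "alpha M X g h \<xi> = (\<integral>\<omega>. w_tilde k \<Omega> f g h (X \<omega>) \<xi> \<partial>M)"
  using truncated_sample[OF g_borel alpha_integrable[OF assms]] w_tilde_sample[OF g_borel assms(1)] by simp_all

lemma AE_num_integrable:
  assumes "c0 < ereal \<xi>" "ereal \<xi> < c1"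
  shows "AE \<omega> in M. set_integrable lborel (einterval c0 \<xi>) (num_integrand k \<Omega> f g h (X \<omega>))"
  by (rule AE_sample)
    (use AE_set_integrable_num_integrand[OF g_borel assms(1) truncated_sample(1)[OF g_borel alpha_integrable[OF assms]]]
      in \<open>auto elim: eventually_mono\<close>)

lemma w_tilde_eq_nu_tilde:
  assumes "c0 < ereal \<xi>"
  shows "w_tilde k \<Omega> f g h x \<xi> = (LINT t:einterval c0 \<xi>|lborel. nu_tilde k \<Omega> f g h x t)"
  using w_tilde_eq[OF g_borel assms, of x] by (simp add: nu_tilde_def set_lebesgue_integral_def)

lemma measurable_nu_tilde [measurable (raw)]:
  assumes [measurable]: "u \<in> N \<rightarrow>\<^sub>M borel" "v \<in> N \<rightarrow>\<^sub>M borel"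
  shows "(\<lambda>w. nu_tilde k \<Omega> f g h (u w) (v w)) \<in> borel_measurable N"
  unfolding nu_tilde_def by measurable

lemma num_integrand_abs:
  "num_integrand k \<Omega> f (\<lambda>y. \<bar>g y\<bar>) h x t = \<bar>num_integrand k \<Omega> f g h x t\<bar>"
  by (simp add: num_integrand_def at_level_def abs_mult f_nonneg J_tilde_def)

text \<open>Because \<open>f\<close>, \<open>J_tilde\<close> and the denominator are nonnegative,
  integrating the absolute value of \<open>nu_tilde\<close> in \<open>t\<close> gives
  \<open>w_tilde\<close> with \<open>\<bar>g\<bar>\<close> in place of \<open>g\<close>; the
  integrability result for \<open>w_tilde\<close> then applies to
  \<open>\<bar>g\<bar>\<close>.\<close>

lemma nu_tilde_product_integrable:
  assumes xi: "c0 < ereal \<xi>" "ereal \<xi> < c1"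
  shows "integrable (M \<Otimes>\<^sub>M lborel) (\<lambda>(\<omega>, t). indicat_real (einterval c0 \<xi>) t * nu_tilde k \<Omega> f g h (X \<omega>) t)"
proof -
  interpret pair_sigma_finite M "lborel :: real measure"
    by (intro pair_sigma_finite.intro sigma_finite_measure_axioms lborel.sigma_finite_measure_axioms)
  have abs_borel: "(\<lambda>y. \<bar>g y\<bar>) \<in> borel_measurable borel" by measurable
  have trunc: "truncated (\<lambda>y. \<bar>g y\<bar>) \<xi> = (\<lambda>y. \<bar>truncated g \<xi> y\<bar>)"
    by (auto simp: truncated_def abs_mult f_nonneg)
  have w_abs: "(\<integral>t. norm (indicat_real (einterval c0 \<xi>) t * nu_tilde k \<Omega> f g h x t) \<partial>lborel) =
      w_tilde k \<Omega> f (\<lambda>y. \<bar>g y\<bar>) h x \<xi>" for x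
    unfolding w_tilde_eq[OF abs_borel xi(1)] set_lebesgue_integral_def
    by (simp add: nu_tilde_def num_integrand_abs abs_mult den_integral_nonneg)
  show ?thesis
  proof (rule Fubini_integrable)
    show "integrable M (\<lambda>\<omega>. \<integral>t. norm (case (\<omega>, t) of (\<omega>, t) \<Rightarrow>
        indicat_real (einterval c0 \<xi>) t * nu_tilde k \<Omega> f g h (X \<omega>) t) \<partial>lborel)"
      unfolding prod.case w_abs
      using truncated_sample(1)[OF g_borel alpha_integrable[OF xi]]
      by (intro w_tilde_sample(1) abs_borel xi) (simp add: trunc)
    show "AE \<omega> in M. integrable lborel (\<lambda>t. case (\<omega>, t) of (\<omega>, t) \<Rightarrow>
        indicat_real (einterval c0 \<xi>) t * nu_tilde k \<Omega> f g h (X \<omega>) t)"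
      using AE_num_integrable[OF xi] by eventually_elim (auto simp: set_integrable_def nu_tilde_def)
  qed measurable
qed

lemma alpha_eq_integral_nu_tilde:
  assumes xi: "c0 < ereal \<xi>" "ereal \<xi> < c1"
  shows "alpha M X g h \<xi> = (\<integral>t. indicat_real (einterval c0 \<xi>) t * (\<integral>\<omega>. nu_tilde k \<Omega> f g h (X \<omega>) t \<partial>M) \<partial>lborel)"
proof -
  interpret pair_sigma_finite M "lborel :: real measure"
    by (intro pair_sigma_finite.intro sigma_finite_measure_axioms lborel.sigma_finite_measure_axioms)
  show ?thesis
    unfolding alpha_eq_w_tilde(2)[OF xi]
    using Fubini_integral[OF nu_tilde_product_integrable[OF xi]]
    by (simp add: w_tilde_eq_nu_tilde xi set_lebesgue_integral_def)
qed

text \<open>Integrability is available only up to levels below \<open>c1\<close>, so the range is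
  exhausted by rational upper ends \<open>r\<close>. Each has its own null set, and there are
  countably many.\<close>

lemma AE_has_derivative_alpha:
  "AE \<xi> in lborel. c0 < ereal \<xi> \<and> ereal \<xi> < c1 \<longrightarrow>
     integrable M (\<lambda>\<omega>. nu_tilde k \<Omega> f g h (X \<omega>) \<xi>) \<and>
     (alpha M X g h has_real_derivative (\<integral>\<omega>. nu_tilde k \<Omega> f g h (X \<omega>) \<xi> \<partial>M)) (at \<xi>)"
proof -
  interpret pair_sigma_finite M "lborel :: real measure"
    by (intro pair_sigma_finite.intro sigma_finite_measure_axioms lborel.sigma_finite_measure_axioms)
  define \<beta> where "\<beta> t = (\<integral>\<omega>. nu_tilde k \<Omega> f g h (X \<omega>) t \<partial>M)" for t
  have "AE \<xi> in lborel. c0 < ereal \<xi> \<and> \<xi> < of_rat r \<and> ereal (of_rat r) < c1 \<longrightarrow>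
     integrable M (\<lambda>\<omega>. nu_tilde k \<Omega> f g h (X \<omega>) \<xi>) \<and> (alpha M X g h has_real_derivative \<beta> \<xi>) (at \<xi>)" for r :: rat
  proof (cases "c0 < ereal (of_rat r) \<and> ereal (of_rat r) < c1")
    case False
    have "\<not> (c0 < ereal \<xi> \<and> \<xi> < of_rat r \<and> ereal (of_rat r) < c1)" for \<xi>
      using False less_trans[of c0 "ereal \<xi>" "ereal (of_rat r)"] by auto
    then show ?thesis by (intro AE_I2) blast
  next
    case True
    let ?r = "of_rat r :: real"
    \<comment> \<open>Cut off at \<open>?r\<close>, the function \<beta> is integrable on the whole
      line, and its integral over \<open>{..y}\<close> is \<open>alpha\<close> at \<open>y\<close>
      for \<open>y\<close> between \<open>c0\<close> and \<open>?r\<close>.\<close>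
    define \<psi> where "\<psi> t = indicat_real (einterval c0 ?r) t * \<beta> t" for t
    note prod_int = nu_tilde_product_integrable[OF True[THEN conjunct1] True[THEN conjunct2]]
    have "integrable lborel \<psi>"
      using integrable_snd[OF prod_int] by (simp add: \<psi>_def[abs_def] \<beta>_def)
    from AE_has_real_derivative_indefinite_integral[OF this] AE_integrable_snd[OF prod_int]
    show ?thesis
    proof (eventually_elim, intro impI conjI)
      fix \<xi> assume xi: "c0 < ereal \<xi> \<and> \<xi> < ?r \<and> ereal ?r < c1"
      then have mem: "\<xi> \<in> einterval c0 ?r" by (simp add: einterval_iff)
      {
        assume "integrable M (\<lambda>\<omega>. indicat_real (einterval c0 ?r) \<xi> * nu_tilde k \<Omega> f g h (X \<omega>) \<xi>)"
        then show "integrable M (\<lambda>\<omega>. nu_tilde k \<Omega> f g h (X \<omega>) \<xi>)" using mem by simp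
      }
      assume "((\<lambda>y. LINT t:{..y}|lborel. \<psi> t) has_real_derivative \<psi> \<xi>) (at \<xi>)"
      then have "((\<lambda>y. LINT t:{..y}|lborel. \<psi> t) has_real_derivative \<beta> \<xi>) (at \<xi>)"
        using mem by (simp add: \<psi>_def)
      then show "(alpha M X g h has_real_derivative \<beta> \<xi>) (at \<xi>)"
      proof (rule has_field_derivative_transform_within_open)
        show "open (einterval c0 ?r)" by simp
        show "\<xi> \<in> einterval c0 ?r" by (rule mem)
        fix y assume "y \<in> einterval c0 ?r"
        then have y: "c0 < ereal y" "y < ?r" "ereal y < c1"
          using xi less_trans[of "ereal y" "ereal ?r" c1] by (auto simp: einterval_iff)
        have "(LINT t:{..y}|lborel. \<psi> t) = (\<integral>t. indicat_real (einterval c0 y) t * \<beta> t \<partial>lborel)"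
          unfolding set_lebesgue_integral_def
        proof (rule integral_cong_AE)
          have [measurable]: "\<beta> \<in> borel_measurable borel"
            unfolding \<beta>_def by measurable
          show "(\<lambda>t. indicat_real {..y} t *\<^sub>R \<psi> t) \<in> borel_measurable lborel"
            unfolding \<psi>_def by measurable
          show "(\<lambda>t. indicat_real (einterval c0 y) t * \<beta> t) \<in> borel_measurable lborel"
            by measurable
          show "AE t in lborel. indicat_real {..y} t *\<^sub>R \<psi> t = indicat_real (einterval c0 y) t * \<beta> t"
            using AE_lborel_singleton[of y] by eventually_elim (use y in \<open>auto simp: \<psi>_def indicator_def einterval_iff\<close>)
        qed
        then show "(LINT t:{..y}|lborel. \<psi> t) = alpha M X g h y"
          using alpha_eq_integral_nu_tilde[OF y(1,3)] by (simp add: \<beta>_def)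
      qed
    qed
  qed
  then have "AE \<xi> in lborel. \<forall>r::rat. c0 < ereal \<xi> \<and> \<xi> < of_rat r \<and> ereal (of_rat r) < c1 \<longrightarrow>
     integrable M (\<lambda>\<omega>. nu_tilde k \<Omega> f g h (X \<omega>) \<xi>) \<and> (alpha M X g h has_real_derivative \<beta> \<xi>) (at \<xi>)"
    by (intro AE_all_countable[THEN iffD2] allI)
  then show ?thesis
  proof (eventually_elim, intro impI)
    fix \<xi> assume *: "\<forall>r::rat. c0 < ereal \<xi> \<and> \<xi> < of_rat r \<and> ereal (of_rat r) < c1 \<longrightarrow>
     integrable M (\<lambda>\<omega>. nu_tilde k \<Omega> f g h (X \<omega>) \<xi>) \<and> (alpha M X g h has_real_derivative \<beta> \<xi>) (at \<xi>)"
      and xi: "c0 < ereal \<xi> \<and> ereal \<xi> < c1"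
    obtain y where y: "\<xi> < y" "ereal y < c1"
      using xi ereal_dense2[of "ereal \<xi>" c1] by auto
    obtain r :: rat where r: "\<xi> < of_rat r" "of_rat r < y" using of_rat_dense y(1) by blast
    then have "ereal (of_rat r) < c1" using y(2) less_trans[of "ereal (of_rat r)" "ereal y" c1] by simp
    with * r xi show "integrable M (\<lambda>\<omega>. nu_tilde k \<Omega> f g h (X \<omega>) \<xi>) \<and>
       (alpha M X g h has_real_derivative (\<integral>\<omega>. nu_tilde k \<Omega> f g h (X \<omega>) \<xi> \<partial>M)) (at \<xi>)"
      unfolding \<beta>_def by blast
  qed
qed

text \<open>A single \<open>r\<close> to the right of \<xi> gives integrability of the numerator for
  all nearby levels at once, so the exceptional null set does not vary with the level.\<close>

lemma AE_w_tilde_has_derivative: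
  assumes xi: "c0 < ereal \<xi>" "ereal \<xi> < c1"
    and cont: "AE \<omega> in M. isCont (num_integrand k \<Omega> f g h (X \<omega>)) \<xi>"
  shows "AE \<omega> in M. (w_tilde k \<Omega> f g h (X \<omega>) has_real_derivative nu_tilde k \<Omega> f g h (X \<omega>) \<xi>) (at \<xi>)"
proof -
  obtain r where r: "\<xi> < r" "ereal r < c1" using xi ereal_dense2[of "ereal \<xi>" c1] by auto
  then have c0r: "c0 < ereal r" using xi(1) less_trans[of c0 "ereal \<xi>" "ereal r"] by simp
  have mem: "\<xi> \<in> einterval c0 r" using xi r by (simp add: einterval_iff)
  from AE_num_integrable[OF c0r r(2)] cont show ?thesis
  proof eventually_elim
    case (elim \<omega>)
    let ?n = "num_integrand k \<Omega> f g h (X \<omega>)" and ?d = "den_integral k \<Omega> f h (X \<omega>)"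
    define \<psi> where "\<psi> t = indicat_real (einterval c0 r) t * ?n t" for t
    have \<psi>: "integrable lborel \<psi>" using elim(1) by (simp add: set_integrable_def \<psi>_def[abs_def])
    have "isCont \<psi> \<xi>"
    proof (rule isCont_cong[THEN iffD2])
      show "\<forall>\<^sub>F t in nhds \<xi>. \<psi> t = ?n t"
        using mem by (intro eventually_nhds[THEN iffD2] exI[of _ "einterval c0 r"]) (auto simp: \<psi>_def)
      show "isCont ?n \<xi>" by (rule elim(2))
    qed
    from has_real_derivative_integral_isCont[OF \<psi> this]
    have "((\<lambda>y. (LINT t:{..y}|lborel. \<psi> t) / ?d) has_real_derivative \<psi> \<xi> / ?d) (at \<xi>)"
      by (rule DERIV_cdivide)
    then have "((\<lambda>y. (LINT t:{..y}|lborel. \<psi> t) / ?d) has_real_derivative nu_tilde k \<Omega> f g h (X \<omega>) \<xi>) (at \<xi>)"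
      using mem by (simp add: \<psi>_def nu_tilde_def)
    then show ?case
    proof (rule has_field_derivative_transform_within_open)
      show "open (einterval c0 r)" by simp
      show "\<xi> \<in> einterval c0 r" by (rule mem)
      fix y assume "y \<in> einterval c0 r"
      then have y: "c0 < ereal y" "y < r" by (auto simp: einterval_iff)
      have "(LINT t:{..y}|lborel. \<psi> t) = (LINT t:einterval c0 y|lborel. ?n t)"
        unfolding set_lebesgue_integral_def
      proof (rule integral_cong_AE)
        show "(\<lambda>t. indicat_real {..y} t *\<^sub>R \<psi> t) \<in> borel_measurable lborel"
          unfolding \<psi>_def by measurable
        show "AE t in lborel. indicat_real {..y} t *\<^sub>R \<psi> t = indicat_real (einterval c0 y) t *\<^sub>R ?n t"
          using AE_lborel_singleton[of y] by eventually_elim (use y in \<open>auto simp: \<psi>_def indicator_def einterval_iff\<close>)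
      qed measurable
      then show "(LINT t:{..y}|lborel. \<psi> t) / ?d = w_tilde k \<Omega> f g h (X \<omega>) y"
        by (simp add: w_tilde_eq y(1))
    qed
  qed
qed

text \<open>The null set in the Lipschitz condition may depend on \<Delta>, so the limit is tested
  along sequences: only countably many null sets then occur, and dominated convergence applies with
  \<open>K\<close> as the bound.\<close>

lemma has_derivative_alpha_if_lipschitz:
  assumes xi: "c0 < ereal \<xi>" "ereal \<xi> < c1"
    and lip: "stoch_lipschitz_at M (\<lambda>\<omega>. w_tilde k \<Omega> f g h (X \<omega>)) \<xi>"
    and cont: "AE \<omega> in M. isCont (num_integrand k \<Omega> f g h (X \<omega>)) \<xi>"
  shows "integrable M (\<lambda>\<omega>. nu_tilde k \<Omega> f g h (X \<omega>) \<xi>)"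
    and "(alpha M X g h has_real_derivative (\<integral>\<omega>. nu_tilde k \<Omega> f g h (X \<omega>) \<xi> \<partial>M)) (at \<xi>)"
proof -
  let ?w = "\<lambda>\<omega>. w_tilde k \<Omega> f g h (X \<omega>)" and ?nu = "\<lambda>\<omega>. nu_tilde k \<Omega> f g h (X \<omega>) \<xi>"
  obtain K where K: "integrable M K"
    and ev: "\<forall>\<^sub>F \<Delta> in at 0. AE \<omega> in M. \<bar>?w \<omega> (\<xi> + \<Delta>) - ?w \<omega> \<xi>\<bar> \<le> K \<omega> * \<bar>\<Delta>\<bar>"
    using lip unfolding stoch_lipschitz_at_def by blast
  \<comment> \<open>Increments must keep the level between \<open>c0\<close> and \<open>c1\<close>,
    where \<open>alpha\<close> equals the expectation of \<open>w_tilde\<close>.\<close>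
  have "\<forall>\<^sub>F \<Delta> in at 0. \<xi> + \<Delta> \<in> einterval c0 c1"
  proof -
    have "((\<lambda>\<Delta>. \<xi> + \<Delta>) \<longlongrightarrow> \<xi> + 0) (at 0)" by (intro tendsto_intros)
    then show ?thesis using xi by (intro topological_tendstoD) (auto simp: einterval_iff)
  qed
  with ev have ev': "\<forall>\<^sub>F \<Delta> in at 0. \<xi> + \<Delta> \<in> einterval c0 c1 \<and>
      (AE \<omega> in M. \<bar>?w \<omega> (\<xi> + \<Delta>) - ?w \<omega> \<xi>\<bar> \<le> K \<omega> * \<bar>\<Delta>\<bar>)" by eventually_elim simp
  have main: "integrable M ?nu \<and>
      (\<lambda>n. (alpha M X g h (\<xi> + S n) - alpha M X g h \<xi>) / S n) \<longlonglongrightarrow> (\<integral>\<omega>. ?nu \<omega> \<partial>M)"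
    if S: "\<And>n. S n \<noteq> 0" "S \<longlonglongrightarrow> 0" for S :: "nat \<Rightarrow> real"
  proof -
    have "filterlim S (at 0) sequentially" using S by (auto simp: filterlim_at)
    with ev' have "\<forall>\<^sub>F n in sequentially. \<xi> + S n \<in> einterval c0 c1 \<and>
      (AE \<omega> in M. \<bar>?w \<omega> (\<xi> + S n) - ?w \<omega> \<xi>\<bar> \<le> K \<omega> * \<bar>S n\<bar>)"
      by (rule eventually_compose_filterlim)
    then obtain N where N: "\<And>n. n \<ge> N \<Longrightarrow> \<xi> + S n \<in> einterval c0 c1"
      "\<And>n. n \<ge> N \<Longrightarrow> AE \<omega> in M. \<bar>?w \<omega> (\<xi> + S n) - ?w \<omega> \<xi>\<bar> \<le> K \<omega> * \<bar>S n\<bar>"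
      unfolding eventually_sequentially by blast
    \<comment> \<open>Shifting by \<open>N\<close> discards the finitely many terms for which the
      bound is not yet guaranteed.\<close>
    let ?Q = "\<lambda>n \<omega>. (?w \<omega> (\<xi> + S (n + N)) - ?w \<omega> \<xi>) / S (n + N)"
    have in_range: "c0 < ereal (\<xi> + S (n + N))" "ereal (\<xi> + S (n + N)) < c1" for n
      using N(1)[of "n + N"] by (auto simp: einterval_iff)
    have int_w: "integrable M (\<lambda>\<omega>. ?w \<omega> (\<xi> + S (n + N)))" for n
      by (rule alpha_eq_w_tilde(1)[OF in_range])
    note int_w0 = alpha_eq_w_tilde(1)[OF xi]
    have meas_nu: "?nu \<in> borel_measurable M" by measurable
    have meas_Q: "?Q n \<in> borel_measurable M" for n
      using borel_measurable_integrable[OF int_w[of n]] borel_measurable_integrable[OF int_w0] by measurable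
    have lim: "AE \<omega> in M. (\<lambda>n. ?Q n \<omega>) \<longlonglongrightarrow> ?nu \<omega>"
      using AE_w_tilde_has_derivative[OF xi cont]
    proof eventually_elim
      case (elim \<omega>)
      then have "((\<lambda>\<Delta>. (?w \<omega> (\<xi> + \<Delta>) - ?w \<omega> \<xi>) / \<Delta>) \<longlongrightarrow> ?nu \<omega>) (at 0)" by (simp add: DERIV_def)
      moreover have "filterlim (\<lambda>n. S (n + N)) (at 0) sequentially"
        using S LIMSEQ_ignore_initial_segment[OF S(2), of N] by (auto simp: filterlim_at)
      ultimately show ?case by (rule filterlim_compose)
    qed
    have bound: "AE \<omega> in M. norm (?Q n \<omega>) \<le> K \<omega>" for n
      using N(2)[of "n + N", simplified]
      by eventually_elim (use S(1)[of "n + N"] in \<open>simp add: field_simps\<close>)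
    note dct = integrable_dominated_convergence[OF meas_nu meas_Q K lim bound]
      integral_dominated_convergence[OF meas_nu meas_Q K lim bound]
    have Q_eq: "integral\<^sup>L M (?Q n) = (alpha M X g h (\<xi> + S (n + N)) - alpha M X g h \<xi>) / S (n + N)" for n
      using int_w[of n] int_w0 by (simp add: alpha_eq_w_tilde(2)[OF in_range] alpha_eq_w_tilde(2)[OF xi])
    have "(\<lambda>n. (alpha M X g h (\<xi> + S (n + N)) - alpha M X g h \<xi>) / S (n + N)) \<longlonglongrightarrow> (\<integral>\<omega>. ?nu \<omega> \<partial>M)"
      using dct(2) unfolding Q_eq .
    with dct(1) show ?thesis
      using LIMSEQ_offset[of "\<lambda>n. (alpha M X g h (\<xi> + S n) - alpha M X g h \<xi>) / S n" N] by blast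
  qed
  \<comment> \<open>The claim mentions no sequence, so any null sequence without zeros will do;
    \<open>1 / Suc n\<close> is taken.\<close>
  show "integrable M ?nu"
    using conjunct1[OF main[OF _ LIMSEQ_Suc[OF lim_1_over_n]]] by simp
  show "(alpha M X g h has_real_derivative (\<integral>\<omega>. ?nu \<omega> \<partial>M)) (at \<xi>)"
    unfolding DERIV_def tendsto_at_iff_sequentially
  proof (intro allI impI)
    fix S :: "nat \<Rightarrow> real" assume "\<forall>i. S i \<in> UNIV - {0}" "S \<longlonglongrightarrow> 0"
    then have "(\<lambda>n. (alpha M X g h (\<xi> + S n) - alpha M X g h \<xi>) / S n) \<longlonglongrightarrow> (\<integral>\<omega>. ?nu \<omega> \<partial>M)"
      using main[of S] by simp
    then show "((\<lambda>\<Delta>. (alpha M X g h (\<xi> + \<Delta>) - alpha M X g h \<xi>) / \<Delta>) \<circ> S) \<longlonglongrightarrow> (\<integral>\<omega>. ?nu \<omega> \<partial>M)"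
      by (simp add: o_def)
  qed
qed

end

end

text \<open>Integrability accompanies each expectation because the integral of a nonintegrable
  function is 0 by convention. The continuity clause concerns \<open>num_integrand\<close> only at
  the level \<xi>, so \<open>g\<close> may jump across other levels.\<close>

theorem proposition1:
  fixes M :: "'w measure"
    and X :: "'w \<Rightarrow> real ^ 'm::finite"
    and k :: 'm
    and f g h :: "real ^ 'm \<Rightarrow> real"
    and \<Omega> U :: "(real ^ 'm) set"
    and c0 c1 :: ereal
  assumes "prob_space M"
    and "\<Omega> \<in> sets borel"
    and "distributed M lborel X (\<lambda>x. ennreal (f x))"
    and "\<And>x. 0 \<le> f x"
    and "\<And>x. x \<notin> \<Omega> \<Longrightarrow> f x = 0"
    and "g \<in> borel_measurable borel"
    and "open U" and "\<Omega> \<subseteq> U" and "continuous_on U h"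
    and "C1_almost_everywhere_on \<Omega> h"
    and "c0 = range_lower \<Omega> h" and "c1 = range_upper \<Omega> h"
    and "\<And>\<xi>. c0 < ereal \<xi> \<Longrightarrow> ereal \<xi> < c1 \<Longrightarrow>
           integrable M (\<lambda>\<omega>. g (X \<omega>) * indicat_real {..\<xi>} (h (X \<omega>)))"
    and "inj_on (\<lambda>x. insert_coord k x (h x)) \<Omega>"
    and "AE \<omega> in M. partial_deriv k h (X \<omega>) \<noteq> 0"
  shows
    "(\<forall>\<xi>. c0 < ereal \<xi> \<and> ereal \<xi> < c1 \<longrightarrow>
        integrable M (\<lambda>\<omega>. w_tilde k \<Omega> f g h (drop_coord k (X \<omega>)) \<xi>) \<and>
        alpha M X g h \<xi> = (\<integral>\<omega>. w_tilde k \<Omega> f g h (drop_coord k (X \<omega>)) \<xi> \<partial>M))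
     \<and>
     (AE \<xi> in lborel. c0 < ereal \<xi> \<and> ereal \<xi> < c1 \<longrightarrow>
        stoch_lipschitz_at M (\<lambda>\<omega>. w_tilde k \<Omega> f g h (drop_coord k (X \<omega>))) \<xi> \<longrightarrow>
        integrable M (\<lambda>\<omega>. nu_tilde k \<Omega> f g h (drop_coord k (X \<omega>)) \<xi>) \<and>
        (alpha M X g h has_real_derivative
           (\<integral>\<omega>. nu_tilde k \<Omega> f g h (drop_coord k (X \<omega>)) \<xi> \<partial>M)) (at \<xi>))
     \<and>
     (\<forall>\<xi>. c0 < ereal \<xi> \<and> ereal \<xi> < c1 \<longrightarrow>
        stoch_lipschitz_at M (\<lambda>\<omega>. w_tilde k \<Omega> f g h (drop_coord k (X \<omega>))) \<xi> \<longrightarrow>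
        (AE \<omega> in M. isCont (num_integrand k \<Omega> f g h (drop_coord k (X \<omega>))) \<xi>) \<longrightarrow>
        integrable M (\<lambda>\<omega>. nu_tilde k \<Omega> f g h (drop_coord k (X \<omega>)) \<xi>) \<and>
        (alpha M X g h has_real_derivative
           (\<integral>\<omega>. nu_tilde k \<Omega> f g h (drop_coord k (X \<omega>)) \<xi> \<partial>M)) (at \<xi>))"
proof -
  interpret prob_space M by fact
  interpret level_coordinate k \<Omega> U h
    by unfold_locales (use assms in auto)
  note distr = assms(3) and nonneg = assms(4) and outside = assms(5)
  have X[measurable]: "X \<in> M \<rightarrow>\<^sub>M borel"
    using distributed_measurable[OF distr] by simp
  have f[measurable]: "f \<in> borel_measurable borel"
    using distributed_real_measurable[OF _ distr] nonneg by simp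
  have f_int: "integrable lborel f"
    using distributed_integrable[OF distr, of "\<lambda>_. 1"] nonneg by simp
  have "\<Omega> \<noteq> {}"
  proof
    assume "\<Omega> = {}"
    then have "f = (\<lambda>_. 0)" using outside by auto
    then show False
      using distributed_integral[OF distr, of "\<lambda>_. 1"] nonneg prob_space by simp
  qed
  moreover have "AE y in lborel. f y \<noteq> 0 \<longrightarrow> partial_deriv k h y \<noteq> 0"
  proof -
    have eq: "distr M lborel X = density lborel (\<lambda>x. ennreal (f x))"
      by (rule distributed_distr_eq_density[OF distr])
    \<comment> \<open>Passing to the distribution of \<open>X\<close> needs a measurable predicate,
      and the partial derivative is known to be Borel only after multiplication by the indicator of
      \<Omega>.\<close>
    let ?P = "\<lambda>y. y \<in> \<Omega> \<longrightarrow> indicat_real \<Omega> y * partial_deriv k h y \<noteq> 0"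
    have "AE \<omega> in M. ?P (X \<omega>)" using assms(15) by eventually_elim simp
    moreover have "{y \<in> space lborel. ?P y} \<in> sets lborel" by measurable
    moreover have "X \<in> M \<rightarrow>\<^sub>M lborel" by simp
    ultimately have "AE y in distr M lborel X. ?P y" by (intro AE_distr_iff[THEN iffD2])
    then have "AE y in lborel. 0 < ennreal (f y) \<longrightarrow> ?P y"
      unfolding eq by (subst (asm) AE_density) auto
    then show ?thesis
    proof eventually_elim
      case (elim y)
      then show ?case using outside[of y] nonneg[of y] by (auto simp: less_le)
    qed
  qed
  ultimately interpret level_sample k \<Omega> U h f M X
    by unfold_locales (use f_int nonneg outside distr in auto)
  have int: "\<And>\<xi>. range_lower \<Omega> h < ereal \<xi> \<Longrightarrow> ereal \<xi> < range_upper \<Omega> h \<Longrightarrow>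
           integrable M (\<lambda>\<omega>. g (X \<omega>) * indicat_real {..\<xi>} (h (X \<omega>)))"
    using assms(11-13) by simp
  show ?thesis
    unfolding assms(11,12)
    using alpha_eq_w_tilde[OF assms(6) int] has_derivative_alpha_if_lipschitz[OF assms(6) int]
      AE_has_derivative_alpha[OF assms(6) int]
    by (auto elim!: eventually_mono)
qed

end
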